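(* Let $d\in\mathbb{N}_0$, $\boldsymbol{c}=(c_1,\ldots,c_d)\in(\mathbb{N}\setminus\{2\})^d$ with $c_1\ge3$ (if $d\ge1$), and $\boldsymbol{z}=(z_0,\ldots,z_d)\in\mathbb{C}^{d+1}$ with $|z_j|<1$. With $c_0=1$, $c_{d+1}=0$, $\delta_i=\delta(c_i)+\delta(c_{i+1})$, $k_{-1}=0$, $$G(\boldsymbol{c};\boldsymbol{z})=\frac{2}{\pi}\sum_{k_0\geq k_1\geq\cdots\geq k_d\geq1}\prod_{i=0}^{d}\frac{(-1)^{k_i\delta_i}(2k_i-1)^{\delta_i-1}}{(2k_i-1)^2-z_i^2}V_{k_{i-1},k_i}^{\#}(\{1\}^{c_i-3}).$$
   Context: For an index $\boldsymbol{s}=(s_1,\ldots,s_r)$ of positive integers with $s_1>1$ (or empty), the multiple $t$-star value is $t^{\star}(\boldsymbol{s})=\sum_{k_1\geq\cdots\geq k_r\geq1}\prod_{j=1}^r(2k_j-1)^{-s_j}$, $t^\star(\emptyset)=1$. $\{s\}^a$ denotes $s$ repeated $a$ times; for $a\le0$, $\{1\}^a$ is empty. $G(\boldsymbol{c};\boldsymbol{z})=\sum_{a_0,\ldots,a_d\geq0}t^{\star}(\{2\}^{a_0},c_1,\{2\}^{a_1},\ldots,c_d,\{2\}^{a_d})z_0^{2a_0}\cdots z_d^{2a_d}$. $\triangle(k,m)=0$ if $k=m$, $1$ otherwise. For an index $\boldsymbol{s}=(s_1,\ldots,s_r)$ and $k,m\in\mathbb{N}_0$: if $\boldsymbol{s}\ne\emptyset$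 and $k\ge m$, $V^{\#}_{k,m}(\boldsymbol{s})=\frac{2k-1}{2m-1}\sum_{k\geq l_1\geq\cdots\geq l_r\geq m}\frac{2^{\triangle(k,l_1)+\triangle(l_1,l_2)+\cdots+\triangle(l_r,m)}}{(2l_1-1)^{s_1}\cdots(2l_r-1)^{s_r}}$; otherwise $V^{\#}_{k,m}(\boldsymbol{s})=\left(2\cdot\frac{2k-1}{2m-1}\right)^{\triangle(k,m)}$. $\delta(0)=2$, $\delta(1)=1$, $\delta(c)=0$ for $c\ge3$. *)

theory Defs
  imports "HOL-Analysis.Analysis"
begin

definition tstar_idx :: "nat \<Rightarrow> nat list set" where
  "tstar_idx r = {k. length k = r \<and> sorted_wrt (\<ge>) k \<and> (\<forall>x\<in>set k. 1 \<le> x)}"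

definition tstar :: "nat list \<Rightarrow> real" where
  "tstar s = infsum (\<lambda>k. \<Prod>j<length s. 1 / (2 * real (k ! j) - 1) ^ (s ! j))
                    (tstar_idx (length s))"

definition G_index :: "nat list \<Rightarrow> nat list \<Rightarrow> nat list" where
  "G_index c a = replicate (a ! 0) 2 @
     concat (map (\<lambda>i. (c ! (i - 1)) # replicate (a ! i) 2) [1..<length c + 1])"

definition G :: "nat list \<Rightarrow> complex list \<Rightarrow> complex" where
  "G c z = infsum (\<lambda>a. complex_of_real (tstar (G_index c a)) *
                        (\<Prod>i\<le>length c. (z ! i) ^ (2 * (a ! i))))
                  {a. length a = length c + 1}"

definition tri :: "nat \<Rightarrow> nat \<Rightarrow> nat" where
  "tri k m = (if k = m then 0 else 1)"

definition tri_chain :: "nat list \<Rightarrow> nat" where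
  "tri_chain xs = sum_list (map2 tri xs (tl xs))"

definition Vsharp :: "nat \<Rightarrow> nat \<Rightarrow> nat list \<Rightarrow> real" where
  "Vsharp k m s =
    (if s \<noteq> [] \<and> k \<ge> m then
       (2 * real k - 1) / (2 * real m - 1) *
       (\<Sum>l\<in>{l. length l = length s \<and> sorted_wrt (\<ge>) l \<and> (\<forall>x\<in>set l. m \<le> x \<and> x \<le> k)}.
          2 ^ tri_chain (k # l @ [m]) / (\<Prod>j<length s. (2 * real (l ! j) - 1) ^ (s ! j)))
     else (2 * ((2 * real k - 1) / (2 * real m - 1))) ^ tri k m)"

definition delta :: "nat \<Rightarrow> nat" where
  "delta c = (if c = 0 then 2 else if c = 1 then 1 else 0)"

definition c_ext :: "nat list \<Rightarrow> nat \<Rightarrow> nat" where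
  "c_ext c i = (if i = 0 then 1 else if i = length c + 1 then 0 else c ! (i - 1))"

definition delta_i :: "nat list \<Rightarrow> nat \<Rightarrow> nat" where
  "delta_i c i = delta (c_ext c i) + delta (c_ext c (i + 1))"

definition k_prev :: "nat list \<Rightarrow> nat \<Rightarrow> nat" where
  "k_prev k i = (if i = 0 then 0 else k ! (i - 1))"

definition rhs_term :: "nat list \<Rightarrow> complex list \<Rightarrow> nat list \<Rightarrow> complex" where
  "rhs_term c z k = (\<Prod>i\<le>length c.
      (-1) ^ (k ! i * delta_i c i) *
      (complex_of_real (2 * real (k ! i) - 1)) powi (int (delta_i c i) - 1) /
      ((complex_of_real (2 * real (k ! i) - 1)) ^ 2 - (z ! i) ^ 2) *
      complex_of_real (Vsharp (k_prev k i) (k ! i) (replicate (c_ext c i - 3) 1)))"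

text \<open>Tuples k_0 >= k_1 >= ... >= k_d >= 1 with k_0 <= N (partial sums).\<close>
definition rhs_idx :: "nat \<Rightarrow> nat \<Rightarrow> nat list set" where
  "rhs_idx d N = {k. length k = d + 1 \<and> sorted_wrt (\<ge>) k \<and> (\<forall>x\<in>set k. 1 \<le> x) \<and> k ! 0 \<le> N}"

end

theory Submission
  imports Defs "HOL-Real_Asymp.Real_Asymp"
begin

text \<open>
  Truncate \<open>G(c; z)\<close> by \<open>k\<^sub>1 \<le> n\<close>. With \<open>c = (c\<^sub>1, c')\<close> and \<open>z = (z\<^sub>0, z')\<close>, the truncations satisfy
  \<open>(1 - z\<^sub>0\<^sup>2/(2n-1)\<^sup>2) G\<^sub>n(c; z) - G\<^sub>n\<^sub>-\<^sub>1(c; z) = (2n-1)\<^sup>-\<^sup>c\<^sup>1 G\<^sub>n(c'; z')\<close>.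
  The same recurrence holds for \<open>\<Sum>\<^sub>k b\<^sub>n\<^sub>,\<^sub>k E\<^sub>k(c; z)\<close>, where \<open>b\<^sub>n\<^sub>,\<^sub>k\<close> are the partial fraction coefficients of
  \<open>\<Prod>\<^sub>l (1 - z\<^sup>2/(2l-1)\<^sup>2)\<^sup>-\<^sup>1\<close> over \<open>1 \<le> l \<le> n\<close> and \<open>E\<^sub>k\<close> is the claimed summand summed over all indices but
  \<open>k\<^sub>0 = k\<close>: this reduces to the telescoping sums \<open>\<Sum>\<^sub>k\<^sub>>\<^sub>m b\<^sub>n\<^sub>,\<^sub>k = (m-n)/(2n-1) b\<^sub>n\<^sub>,\<^sub>m\<close> (for \<open>c\<^sub>1 \<ge> 3\<close>, iterated
  \<open>c\<^sub>1 - 2\<close> times) and \<open>\<Sum>\<^sub>k\<^sub>>\<^sub>m (-1)\<^sup>k (2k-1) b\<^sub>n\<^sub>,\<^sub>k = (n-m) (-1)\<^sup>m b\<^sub>n\<^sub>,\<^sub>m\<close> (for \<open>c\<^sub>1 = 1\<close>).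
  By Wallis' product \<open>b\<^sub>n\<^sub>,\<^sub>k\<close> tends to \<open>-(4/\<pi>) (-1)\<^sup>k\<close>, boundedly, so the theorem is the limit of the finite
  identity: for \<open>c\<^sub>1 \<ge> 3\<close> by dominated convergence, and for empty \<open>c\<close> after splitting off Leibniz' series.
\<close>


section \<open>The partial fraction coefficients\<close>

text \<open>This is \<open>b\<^sub>n\<^sub>,\<^sub>1\<close>; the value at 0 makes the recursion \<open>kern_Suc\<close> hold from \<open>n = 0\<close> on.\<close>

primrec wallis_part :: "nat \<Rightarrow> real" where
  "wallis_part 0 = 0"
| "wallis_part (Suc n) = (if n = 0 then 1
     else wallis_part n * (2 * real n + 1)\<^sup>2 / (4 * real n * (real n + 1)))"

text \<open>
  The coefficient \<open>b\<^sub>n\<^sub>,\<^sub>k\<close> for \<open>k \<ge> 1\<close>. The recursion comes from the closed form proportional to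
  \<open>(-1)\<^sup>k / ((n-k)! (n+k-1)!)\<close> and yields 0 for \<open>k > n\<close>; index 0 is only a starting value.
\<close>

primrec kern :: "nat \<Rightarrow> nat \<Rightarrow> real" where
  "kern n 0 = - wallis_part n"
| "kern n (Suc k) = (real k - real n) / (real n + real k) * kern n k"

lemma wallis_part_nonneg: "wallis_part n \<ge> 0"
  by (induction n) auto

text \<open>Unrolls the recursion into the partial Wallis product with its known limit
  \<open>pi / 2\<close>; the prefactor tends to 2, hence the limit \<open>4 / pi\<close>
  below.\<close>

lemma wallis_part_eq_prod:
  "wallis_part (Suc n) = (2 * real n + 1) / (real n + 1) / (\<Prod>k=1..n. (4 * real k ^ 2) / (4 * real k ^ 2 - 1))"
proof (induction n)
  case (Suc n)
  define x where "x = real n"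
  define P where "P = (\<Prod>k=1..n. (4 * real k ^ 2) / (4 * real k ^ 2 - 1))"
  have P: "P > 0"
    unfolding P_def
  proof (rule prod_pos)
    fix k assume "k \<in> {1..n}"
    hence "real k ^ 2 \<ge> 1" by simp
    thus "0 < 4 * (real k)\<^sup>2 / (4 * (real k)\<^sup>2 - 1)" by (intro divide_pos_pos) linarith+
  qed
  have x: "x \<ge> 0" by (simp add: x_def)
  have "wallis_part (Suc (Suc n)) = wallis_part (Suc n) * (2 * x + 3)\<^sup>2 / (4 * (x + 1) * (x + 2))"
    by (simp add: x_def algebra_simps)
  also have "\<dots> = (2 * x + 1) / (x + 1) / P * (2 * x + 3)\<^sup>2 / (4 * (x + 1) * (x + 2))"
    using Suc by (simp add: x_def P_def)
  also have "\<dots> = (2 * x + 3) / (x + 2) / (P * ((4 * (x + 1)^2) / ((2 * x + 1) * (2 * x + 3))))"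
    using x P by (simp add: divide_simps) (simp add: power2_eq_square algebra_simps)
  also have "(2 * x + 1) * (2 * x + 3) = 4 * (x + 1)^2 - 1"
    by (simp add: power2_eq_square algebra_simps)
  finally show ?case
    by (simp add: x_def P_def algebra_simps)
qed auto

lemma wallis_part_LIMSEQ: "wallis_part \<longlonglongrightarrow> 4 / pi"
proof -
  have "(\<lambda>n. (2 * real n + 1) / (real n + 1)) \<longlonglongrightarrow> 2"
    by real_asymp
  hence "(\<lambda>n. wallis_part (Suc n)) \<longlonglongrightarrow> 2 / (pi / 2)"
    unfolding wallis_part_eq_prod by (intro tendsto_divide wallis) auto
  thus ?thesis
    by (simp only: filterlim_sequentially_Suc) simp
qed

lemma kern_eq_0: "n < k \<Longrightarrow> kern n k = 0"
  by (induction k) (auto simp: less_Suc_eq)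

text \<open>Every ratio in the recursion has absolute value at most 1, so the starting value
  dominates. The bound is uniform in \<open>k\<close>, as the passage to the limit requires.\<close>

lemma abs_kern_le: "\<bar>kern n k\<bar> \<le> wallis_part n"
proof (induction k)
  case 0
  show ?case using wallis_part_nonneg[of n] by simp
next
  case (Suc k)
  have "\<bar>(real k - real n) / (real n + real k)\<bar> \<le> 1"
    by (simp add: abs_le_iff divide_le_eq)
  hence "\<bar>(real k - real n) / (real n + real k)\<bar> * \<bar>kern n k\<bar> \<le> 1 * wallis_part n"
    using Suc by (intro mult_mono) auto
  thus ?case by (simp only: kern.simps abs_mult mult_1)
qed

lemma kern_LIMSEQ: "(\<lambda>n. kern n k) \<longlonglongrightarrow> - (4 / pi) * (-1) ^ k"
proof (induction k)
  case 0
  show ?case using wallis_part_LIMSEQ by (auto intro!: tendsto_eq_intros)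
next
  case (Suc k)
  have "(\<lambda>n. (real k - real n) / (real n + real k)) \<longlonglongrightarrow> - 1"
    by real_asymp
  from tendsto_mult[OF this Suc] show ?case by simp
qed

text \<open>Adding the factor \<open>l = n + 1\<close> to the product divides the coefficient at the
  pole \<open>2 * k - 1\<close> by the value of \<open>1 - z^2 / (2 * n + 1)^2\<close> there. For
  \<open>k = n + 1\<close> both sides are 0.\<close>

lemma kern_Suc:
  "kern n k = kern (Suc n) k * (1 - ((2 * real k - 1) / (2 * real n + 1))\<^sup>2)"
proof -
  have *: "1 - ((2 * real k - 1) / (2 * real n + 1))\<^sup>2 =
          4 * (real n + 1 - real k) * (real n + real k) / (2 * real n + 1)\<^sup>2" for k
    by (simp add: power_divide divide_simps) (simp add: power2_eq_square algebra_simps)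
  have "kern n k = kern (Suc n) k * (4 * (real n + 1 - real k) * (real n + real k) / (2 * real n + 1)\<^sup>2)"
  proof (induction k)
    case 0
    show ?case
    proof (cases "n = 0")
      case False
      hence "kern n 0 = kern (Suc n) 0 * (4 * real n * (real n + 1) / (2 * real n + 1)\<^sup>2)"
        by simp
      thus ?thesis by (simp add: mult_ac del: kern.simps)
    qed auto
  next
    case (Suc k)
    show ?case
    proof (cases "n = 0 \<and> k = 0")
      case False
      hence "real n + real k > 0" by linarith
      thus ?thesis
        unfolding kern.simps Suc.IH by (simp add: divide_simps) (simp add: power2_eq_square algebra_simps)
    qed auto
  qed
  thus ?thesis by (simp only: *)
qed

text \<open>Downward induction from the empty sum at \<open>m = n\<close>: one step of the recursion
  turns the closed form at \<open>m + 1\<close> into the one at \<open>m\<close>.\<close>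

lemma sum_kern:
  assumes "1 \<le> n" "m \<le> n"
  shows   "(\<Sum>k=Suc m..n. kern n k) = (real m - real n) / (2 * real n - 1) * kern n m"
  using assms(2)
proof (induction m rule: inc_induct)
  case (step m)
  have "(\<Sum>k=Suc m..n. kern n k) = kern n (Suc m) + (\<Sum>k=Suc (Suc m)..n. kern n k)"
    using step.hyps by (subst sum.atLeast_Suc_atMost) auto
  also have "\<dots> = kern n (Suc m) * (1 + (real (Suc m) - real n) / (2 * real n - 1))"
    by (simp add: step.IH algebra_simps del: kern.simps)
  also have "\<dots> = (real m - real n) / (2 * real n - 1) * kern n m"
    using assms(1) step.hyps by (simp add: divide_simps)
  finally show ?case .
qed auto

lemma sum_kern_alternating:
  assumes "m \<le> n"
  shows   "(\<Sum>k=Suc m..n. (-1) ^ k * (2 * real k - 1) * kern n k) = (real n - real m) * ((-1) ^ m * kern n m)"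
  using assms
proof (induction m rule: inc_induct)
  case (step m)
  have "(\<Sum>k=Suc m..n. (-1) ^ k * (2 * real k - 1) * kern n k) =
        (-1) ^ Suc m * (2 * real (Suc m) - 1) * kern n (Suc m) +
        (\<Sum>k=Suc (Suc m)..n. (-1) ^ k * (2 * real k - 1) * kern n k)"
    using step.hyps by (subst sum.atLeast_Suc_atMost) auto
  also have "\<dots> = - ((-1) ^ m * kern n (Suc m) * (real n + real m))"
    unfolding step.IH by (simp add: algebra_simps del: kern.simps)
  also have "\<dots> = (real n - real m) * ((-1) ^ m * kern n m)"
    using step.hyps by (simp add: divide_simps) (simp add: algebra_simps)
  finally show ?case .
qed auto

text \<open>Up to sign this is the coefficient of \<open>z^(-2)\<close> at infinity in the partial
  fraction expansion; it vanishes since a product of \<open>n \<ge> 2\<close> factors decays like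
  \<open>z^(-2 * n)\<close>.\<close>

lemma sum_odd_kern:
  assumes "2 \<le> n"
  shows   "(\<Sum>k=1..n. (2 * real k - 1) * kern n k) = 0"
proof -
  \<comment> \<open>The closed form of the tails has a factor \<open>real m\<close>, so the full
    sum, which is the case \<open>m = 0\<close>, vanishes.\<close>
  have "(\<Sum>k=Suc m..n. (2 * real k - 1) * kern n k) =
          real m * (real m - real n) / (real n - 1) * kern n m" if "m \<le> n" for m
    using that
  proof (induction m rule: inc_induct)
    case (step m)
    have "(\<Sum>k=Suc m..n. (2 * real k - 1) * kern n k) =
          (2 * real (Suc m) - 1) * kern n (Suc m) + (\<Sum>k=Suc (Suc m)..n. (2 * real k - 1) * kern n k)"
      using step.hyps by (subst sum.atLeast_Suc_atMost) auto
    also have "\<dots> = kern n (Suc m) * (2 * real m + 1 + (real m + 1) * (real m + 1 - real n) / (real n - 1))"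
      unfolding step.IH by (simp add: algebra_simps del: kern.simps)
    also have "2 * real m + 1 + (real m + 1) * (real m + 1 - real n) / (real n - 1) = real m * (real n + real m) / (real n - 1)"
      using assms by (simp add: divide_simps) (simp add: algebra_simps)
    also have "kern n (Suc m) * \<dots> = real m * (real m - real n) / (real n - 1) * kern n m"
      using step.hyps by simp
    finally show ?case .
  qed auto
  from this[of 0] assms show ?thesis by simp
qed

section \<open>The finite identity\<close>

definition chain_idx :: "nat \<Rightarrow> nat \<Rightarrow> nat \<Rightarrow> nat list set" where
  "chain_idx r m n = {l. length l = r \<and> sorted_wrt (\<ge>) l \<and> (\<forall>x\<in>set l. m \<le> x \<and> x \<le> n)}"

lemma finite_chain_idx: "finite (chain_idx r m n)"
  by (rule finite_subset[OF _ finite_lists_length_eq[of "{m..n}" r]]) (auto simp: chain_idx_def)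

lemma chain_idx_0: "chain_idx 0 m n = {[]}"
  by (auto simp: chain_idx_def)

lemma chain_idx_Suc:
  "chain_idx (Suc r) m n = (\<lambda>(k, l). k # l) ` (SIGMA k:{m..n}. chain_idx r m k)"
proof (intro equalityI subsetI)
  fix l assume l: "l \<in> chain_idx (Suc r) m n"
  then obtain k l' where "l = k # l'" by (cases l) (auto simp: chain_idx_def)
  with l show "l \<in> (\<lambda>(k, l). k # l) ` (SIGMA k:{m..n}. chain_idx r m k)"
    by (auto simp: chain_idx_def image_iff)
qed (fastforce simp: chain_idx_def)

lemma sum_chain_idx_Suc:
  "(\<Sum>l\<in>chain_idx (Suc r) m n. f l) = (\<Sum>k=m..n. \<Sum>l\<in>chain_idx r m k. f (k # l))"
proof -
  have "inj_on (\<lambda>(k, l). k # l) A" for A :: "(nat \<times> nat list) set"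
    by (auto simp: inj_on_def)
  thus ?thesis
    unfolding chain_idx_Suc
    by (subst sum.reindex) (auto simp: sum.Sigma finite_chain_idx case_prod_unfold)
qed

text \<open>The nested sum inside \<open>Vsharp\<close> for exponents all equal to 1, without the
  factor \<open>(2 * k - 1) / (2 * m - 1)\<close>, arranged to peel off the outermost index.\<close>

primrec chain_sum :: "nat \<Rightarrow> nat \<Rightarrow> nat \<Rightarrow> real" where
  "chain_sum 0 k m = 2 ^ tri k m"
| "chain_sum (Suc r) k m = (\<Sum>l=m..k. 2 ^ tri k l / (2 * real l - 1) * chain_sum r l m)"

lemma tri_chain_Cons: "tri_chain (k # l # xs) = tri k l + tri_chain (l # xs)"
  by (simp add: tri_chain_def)

lemma sum_chain_idx_eq_chain_sum:
  "(\<Sum>l\<in>chain_idx r m k. 2 ^ tri_chain (k # l @ [m]) / (\<Prod>j<r. 2 * real (l ! j) - 1)) = chain_sum r k m"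
proof (induction r arbitrary: k)
  case 0
  show ?case by (simp add: chain_idx_0 tri_chain_def)
next
  case (Suc r)
  show ?case
    unfolding sum_chain_idx_Suc
    by (simp add: tri_chain_Cons power_add prod.lessThan_Suc_shift sum_distrib_left Suc.IH [symmetric]
             del: prod.lessThan_Suc)
qed

lemma odd_real_neq_0: "2 * real k - 1 \<noteq> 0"
proof
  assume "2 * real k - 1 = 0"
  hence "real (2 * k) = real 1" by simp
  thus False unfolding of_nat_eq_iff by presburger
qed

text \<open>Both branches of \<open>Vsharp\<close> fit: for \<open>r = 0\<close> and
  \<open>k = m\<close> the ratio is 1, so the exponent \<open>tri k m\<close> affects only the
  factor 2.\<close>

lemma Vsharp_replicate:
  assumes "m \<le> k"
  shows   "Vsharp k m (replicate r 1) = (2 * real k - 1) / (2 * real m - 1) * chain_sum r k m"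
proof (cases "r = 0")
  case True
  thus ?thesis using odd_real_neq_0[of k]
    by (auto simp: Vsharp_def tri_def)
next
  case False
  have "(\<Sum>l\<in>chain_idx r m k. 2 ^ tri_chain (k # l @ [m]) /
           (\<Prod>j<r. (2 * real (l ! j) - 1) ^ (replicate r 1 ! j))) = chain_sum r k m"
    by (subst sum_chain_idx_eq_chain_sum [symmetric]) (intro sum.cong prod.cong arg_cong2[of _ _ _ _ "(/)"]; simp)
  thus ?thesis using False assms
    by (simp add: Vsharp_def chain_idx_def)
qed

lemma sum_triangle_swap:
  "(\<Sum>k=m..n. \<Sum>l=m..k. f k l) = (\<Sum>l=m..n. \<Sum>k=l..(n::nat). f k l)" 
proof -
  have "(\<Sum>k=m..n. \<Sum>l=m..k. f k l) = (\<Sum>k=m..n. \<Sum>l\<in>{l. l \<in> {m..n} \<and> l \<le> k}. f k l)"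
    by (intro sum.cong) auto
  also have "\<dots> = (\<Sum>l=m..n. \<Sum>k\<in>{k. k \<in> {m..n} \<and> l \<le> k}. f k l)"
    by (rule sum.swap_restrict) auto
  also have "\<dots> = (\<Sum>l=m..n. \<Sum>k=l..n. f k l)"
    by (intro sum.cong) auto
  finally show ?thesis .
qed

text \<open>This is the effect of the weight 2 off the diagonal:
  \<open>1 + 2 * (m - n) / (2 * n - 1) = (2 * m - 1) / (2 * n - 1)\<close>, so the weighted sum
  reproduces \<open>kern\<close> up to a simple factor.\<close>

lemma sum_kern_tri:
  assumes "1 \<le> n" "m \<le> n"
  shows   "(\<Sum>k=m..n. kern n k * 2 ^ tri k m) = (2 * real m - 1) / (2 * real n - 1) * kern n m"
proof -
  have "(\<Sum>k=m..n. kern n k * 2 ^ tri k m) = kern n m + (\<Sum>k=Suc m..n. kern n k * 2)"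
    using assms by (subst sum.atLeast_Suc_atMost) (auto simp: tri_def)
  also have "(\<Sum>k=Suc m..n. kern n k * 2) = (real m - real n) / (2 * real n - 1) * kern n m * 2"
    by (simp only: sum_kern[OF assms, symmetric] sum_distrib_right)
  also have "kern n m + \<dots> = (2 * real m - 1) / (2 * real n - 1) * kern n m"
    using odd_real_neq_0[of n] by (simp add: divide_simps) (simp add: algebra_simps)
  finally show ?thesis .
qed

text \<open>Summing over the outermost index first, \<open>sum_kern_tri\<close> reproduces
  \<open>kern n l\<close> with a factor \<open>2 * l - 1\<close> that cancels the denominator in
  \<open>chain_sum\<close>. Each level contributes one factor
  \<open>1 / (2 * n - 1)\<close>.\<close>

lemma sum_kern_chain_sum:
  assumes "1 \<le> n" "m \<le> n"
  shows   "(\<Sum>k=m..n. kern n k * chain_sum r k m) = (2 * real m - 1) / (2 * real n - 1) ^ Suc r * kern n m"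
proof (induction r)
  case 0
  show ?case using sum_kern_tri[OF assms] by simp
next
  case (Suc r)
  have "(\<Sum>k=m..n. kern n k * chain_sum (Suc r) k m) =
        (\<Sum>k=m..n. \<Sum>l=m..k. kern n k * 2 ^ tri k l * (chain_sum r l m / (2 * real l - 1)))"
    by (simp add: sum_distrib_left mult_ac)
  also have "\<dots> = (\<Sum>l=m..n. (\<Sum>k=l..n. kern n k * 2 ^ tri k l) * (chain_sum r l m / (2 * real l - 1)))"
    by (simp only: sum_triangle_swap sum_distrib_right)
  also have "\<dots> = (\<Sum>l=m..n. kern n l * chain_sum r l m / (2 * real n - 1))"
    using odd_real_neq_0 assms by (intro sum.cong) (simp_all add: sum_kern_tri)
  also have "\<dots> = (2 * real m - 1) / (2 * real n - 1) ^ Suc (Suc r) * kern n m"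
    unfolding sum_divide_distrib [symmetric] Suc.IH by simp
  finally show ?case .
qed

text \<open>After the division by \<open>(2 * n - 1)^2\<close> that comes from
  \<open>kern_difference\<close>, an entry \<open>x\<close> of \<open>c\<close> contributes just the
  factor \<open>(2 * n - 1)^(-x)\<close> of the recurrence.\<close>

lemma sum_kern_Vsharp:
  assumes "1 \<le> m" "m \<le> n" "1 \<le> x" "x \<noteq> 2"
  shows   "(\<Sum>k=m..n. kern n k * (((-1) ^ k * (2 * real k - 1)) ^ delta x / (2 * real k - 1) *
              Vsharp k m (replicate (x - 3) 1) * ((-1) ^ m * (2 * real m - 1)) ^ delta x)) =
           kern n m * (2 * real n - 1)\<^sup>2 / (2 * real n - 1) ^ x"
proof (cases "x = 1")
  case True
  \<comment> \<open>Here \<open>x - 3\<close> truncates to 0, and \<open>Vsharp k m []\<close> is 1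
    for \<open>k = m\<close> but \<open>2 * (2 * k - 1) / (2 * m - 1)\<close> for
    \<open>k > m\<close>, so the diagonal term is split off.\<close>
  have "(\<Sum>k=m..n. kern n k * ((-1) ^ k * Vsharp k m [] * ((-1) ^ m * (2 * real m - 1)))) =
        kern n m * (2 * real m - 1) +
        (\<Sum>k=Suc m..n. kern n k * ((-1) ^ k * Vsharp k m [] * ((-1) ^ m * (2 * real m - 1))))"
    using assms by (subst sum.atLeast_Suc_atMost) (auto simp: Vsharp_def tri_def)
  also have "(\<Sum>k=Suc m..n. kern n k * ((-1) ^ k * Vsharp k m [] * ((-1) ^ m * (2 * real m - 1)))) =
        (\<Sum>k=Suc m..n. 2 * (-1) ^ m * ((-1) ^ k * (2 * real k - 1) * kern n k))"
    using odd_real_neq_0[of m] by (intro sum.cong) (auto simp: Vsharp_def tri_def)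
  also have "\<dots> = 2 * (-1) ^ m * ((real n - real m) * ((-1) ^ m * kern n m))"
    using assms by (subst sum_kern_alternating [symmetric]) (auto simp: sum_distrib_left)
  also have "\<dots> = 2 * ((-1) ^ m * (-1) ^ m) * (real n - real m) * kern n m"
    by (simp only: mult_ac)
  also have "\<dots> = 2 * (real n - real m) * kern n m"
    by (simp add: power_mult_distrib [symmetric])
  also have "kern n m * (2 * real m - 1) + \<dots> = kern n m * (2 * real n - 1)"
    by (simp add: algebra_simps)
  finally show ?thesis
    using True odd_real_neq_0 by (simp add: delta_def power2_eq_square)
next
  case False
  with assms have x: "x \<ge> 3" by simp
  define r where "r = x - 3"
  have xr: "x = Suc r + 2" using x by (simp add: r_def)
  have "(\<Sum>k=m..n. kern n k * (Vsharp k m (replicate r 1) / (2 * real k - 1))) =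
        (\<Sum>k=m..n. kern n k * chain_sum r k m) / (2 * real m - 1)"
    unfolding sum_divide_distrib
    using odd_real_neq_0 by (intro sum.cong) (auto simp: Vsharp_replicate simp del: One_nat_def)
  also have "\<dots> = kern n m / (2 * real n - 1) ^ Suc r"
    using assms odd_real_neq_0 by (subst sum_kern_chain_sum) auto
  also have "\<dots> = kern n m * (2 * real n - 1)\<^sup>2 / (2 * real n - 1) ^ x"
    unfolding xr power_add using odd_real_neq_0 by simp
  finally show ?thesis
    using x by (simp add: delta_def r_def)
qed

text \<open>The truncated \<open>G\<close>, defined by its recurrence solved for the new value;
  \<open>G_summand_has_sum\<close> identifies it with the power series. At \<open>n = 0\<close> only
  the empty index contributes. The type is general because real arguments give majorants for complex
  ones.\<close>

fun G_upto :: "nat \<Rightarrow> nat list \<Rightarrow> 'a::real_normed_field list \<Rightarrow> 'a" where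
  "G_upto 0 c z = (if c = [] then 1 else 0)"
| "G_upto (Suc n) [] z = G_upto n [] z / (1 - (hd z / of_real (2 * real n + 1))\<^sup>2)"
| "G_upto (Suc n) (x # c) z = (G_upto n (x # c) z + G_upto (Suc n) c (tl z) / of_real (2 * real n + 1) ^ x) /
     (1 - (hd z / of_real (2 * real n + 1))\<^sup>2)"

text \<open>The sum over \<open>k\<^sub>1, \<dots>, k\<^sub>d\<close> for fixed \<open>k\<^sub>0 = k\<close>, without the factors that involve \<open>c\<^sub>0\<close>.\<close>

fun pf_term :: "nat list \<Rightarrow> complex list \<Rightarrow> nat \<Rightarrow> complex" where
  "pf_term [] z k = of_real (2 * real k - 1) / (of_real (2 * real k - 1) ^ 2 - (hd z)\<^sup>2)"
| "pf_term (x # c) z k =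
     (\<Sum>m=1..k. of_real (((-1) ^ k * (2 * real k - 1)) ^ delta x / (2 * real k - 1) *
        Vsharp k m (replicate (x - 3) 1) * ((-1) ^ m * (2 * real m - 1)) ^ delta x) * pf_term c (tl z) m) /
     (of_real (2 * real k - 1) ^ 2 - (hd z)\<^sup>2)"

lemma one_minus_square_neq_0:
  fixes z :: "'a::real_normed_field"
  assumes "norm z < 1"
  shows   "1 - (z / of_real (2 * real n + 1))\<^sup>2 \<noteq> 0"
proof
  assume "1 - (z / of_real (2 * real n + 1))\<^sup>2 = 0"
  hence "norm ((z / of_real (2 * real n + 1))\<^sup>2) = norm (1::'a)" by simp
  hence "norm z / (2 * real n + 1) = 1"
    by (simp add: norm_power norm_divide power2_eq_1_iff del: of_real_add of_real_mult)
       (smt (verit) norm_ge_zero of_nat_0_le_iff divide_nonneg_nonneg)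
  with assms show False by (simp add: divide_simps split: if_splits)
qed

lemma odd_square_neq:
  fixes z :: "'a::real_normed_field"
  assumes "norm z < 1" "1 \<le> k"
  shows   "of_real (2 * real k - 1) ^ 2 \<noteq> z\<^sup>2"
proof
  assume "of_real (2 * real k - 1) ^ 2 = z\<^sup>2"
  hence "norm (of_real (2 * real k - 1) ^ 2 :: 'a) = norm (z\<^sup>2)" by simp
  hence "\<bar>2 * real k - 1\<bar> ^ 2 = norm z ^ 2"
    by (simp only: norm_power norm_of_real)
  hence "\<bar>2 * real k - 1\<bar> = norm z"
    by (metis abs_ge_zero norm_ge_zero power2_eq_iff_nonneg)
  with assms show False by simp
qed

text \<open>With \<open>K = 2 * k - 1\<close> and \<open>N = 2 * n + 1\<close>,
  \<open>kern_Suc\<close> reduces this to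
  \<open>(1 - z^2/N^2) - (1 - K^2/N^2) = (K^2 - z^2)/N^2\<close>, which cancels the denominator of
  \<open>pf_term\<close>.\<close>

lemma kern_difference:
  fixes z e :: complex
  shows "of_real (kern (Suc n) k) * e * (1 - (z / of_real (2 * real n + 1))\<^sup>2) - of_real (kern n k) * e =
         of_real (kern (Suc n) k) * ((of_real (2 * real k - 1) ^ 2 - z\<^sup>2) * e) / of_real (2 * real n + 1) ^ 2"
proof -
  have *: "b * e * (1 - (z / N)\<^sup>2) - b * (1 - (K / N)\<^sup>2) * e = b * ((K\<^sup>2 - z\<^sup>2) * e) / N\<^sup>2"
    if "N \<noteq> 0" for b K N :: complex
    using that by (simp add: power_divide field_simps)
  have "(of_real (2 * real n + 1) :: complex) \<noteq> 0"
    unfolding of_real_eq_0_iff by linarith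
  note * = *[OF this]
  have "complex_of_real (1 - ((2 * real k - 1) / (2 * real n + 1))\<^sup>2) =
      1 - (of_real (2 * real k - 1) / of_real (2 * real n + 1))\<^sup>2"
    by simp
  thus ?thesis unfolding kern_Suc[of n k] of_real_mult
    by (simp only: *)
qed

text \<open>Both sides satisfy the same recurrence in \<open>n\<close>, whose inhomogeneous term
  comes from the induction on \<open>c\<close>. For \<open>c = []\<close> and \<open>n = 0\<close>
  the left side is 1 but the sum is empty, so this case is excluded.\<close>

lemma G_upto_eq_sum_kern:
  assumes "length z = length c + 1" "\<forall>w\<in>set z. norm w < 1" "\<forall>x\<in>set c. 1 \<le> x \<and> x \<noteq> 2"
    and "1 \<le> n \<or> c \<noteq> []"
  shows   "G_upto n c z = (\<Sum>k=1..n. of_real (kern n k) * pf_term c z k)"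
  using assms
proof (induction c arbitrary: z n)
  case (Nil z n)
  have z: "norm (hd z) < 1" using Nil by (cases z) auto
  from Nil.prems have "1 \<le> n" by simp
  thus ?case
  proof (induction n rule: nat_induct_at_least)
    case base
    show ?case by (simp add: one_minus_square_neq_0)
  next
    case (Suc n)
    define u where "u = 1 - (hd z / of_real (2 * real n + 1))\<^sup>2"
    have u: "u \<noteq> 0" unfolding u_def by (rule one_minus_square_neq_0[OF z])
    \<comment> \<open>The second sum may run to \<open>Suc n\<close> as well, because
      \<open>kern n (Suc n) = 0\<close>.\<close>
    have "(\<Sum>k=1..Suc n. of_real (kern (Suc n) k) * pf_term [] z k) * u - (\<Sum>k=1..n. of_real (kern n k) * pf_term [] z k) =
          (\<Sum>k=1..Suc n. of_real (kern (Suc n) k) * pf_term [] z k * u - of_real (kern n k) * pf_term [] z k)"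
      unfolding sum_distrib_right sum_subtractf by (simp add: kern_eq_0 del: kern.simps pf_term.simps)
    also have "\<dots> = (\<Sum>k=1..Suc n. of_real ((2 * real k - 1) * kern (Suc n) k)) / of_real (2 * real n + 1) ^ 2"
      unfolding u_def kern_difference sum_divide_distrib
      by (intro sum.cong) (simp_all add: odd_square_neq[OF z] del: kern.simps of_real_add of_real_diff)
    also have "\<dots> = 0"
      using Suc.hyps by (simp only: of_real_sum [symmetric]) (simp only: sum_odd_kern[of "Suc n"]; simp)
    finally have "(\<Sum>k=1..Suc n. of_real (kern (Suc n) k) * pf_term [] z k) * u = G_upto n [] z"
      by (simp only: Suc.IH) simp
    thus ?case unfolding G_upto.simps u_def [symmetric] nonzero_divide_eq_eq[OF u] by (rule sym)
  qed
next
  case (Cons x c z n)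
  have z: "norm (hd z) < 1" using Cons.prems by (cases z) auto
  have tl: "length (tl z) = length c + 1" "\<forall>w\<in>set (tl z). norm w < 1"
    using Cons.prems by (cases z; auto)+
  have x: "1 \<le> x" "x \<noteq> 2" using Cons.prems by auto
  show ?case
  proof (induction n)
    case (Suc n)
    define u where "u = 1 - (hd z / of_real (2 * real n + 1))\<^sup>2"
    have u: "u \<noteq> 0" unfolding u_def by (rule one_minus_square_neq_0[OF z])
    define v where "v = (\<lambda>k m. ((-1) ^ k * (2 * real k - 1)) ^ delta x / (2 * real k - 1) *
              Vsharp k m (replicate (x - 3) 1) * ((-1) ^ m * (2 * real m - 1)) ^ delta x)"
    have n: "of_real (2 * real n + 1) \<noteq> (0 :: complex)"
      unfolding of_real_eq_0_iff by linarith
    have "(\<Sum>k=1..Suc n. of_real (kern (Suc n) k) * pf_term (x # c) z k) * u - (\<Sum>k=1..n. of_real (kern n k) * pf_term (x # c) z k) =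
          (\<Sum>k=1..Suc n. of_real (kern (Suc n) k) * pf_term (x # c) z k * u - of_real (kern n k) * pf_term (x # c) z k)"
      unfolding sum_distrib_right sum_subtractf by (simp add: kern_eq_0 del: kern.simps pf_term.simps)
    also have "\<dots> = (\<Sum>k=1..Suc n. of_real (kern (Suc n) k) * (\<Sum>m=1..k. of_real (v k m) * pf_term c (tl z) m)) / of_real (2 * real n + 1) ^ 2"
      unfolding u_def kern_difference sum_divide_distrib
      by (intro sum.cong) (simp_all add: v_def odd_square_neq[OF z] del: kern.simps of_real_add of_real_diff of_real_mult of_real_divide)
    \<comment> \<open>Swapping the sums makes the inner one a sum over \<open>k\<close> with
      \<open>m\<close> fixed, ready for \<open>sum_kern_Vsharp\<close>.\<close>
    also have "(\<Sum>k=1..Suc n. of_real (kern (Suc n) k) * (\<Sum>m=1..k. of_real (v k m) * pf_term c (tl z) m)) =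
               (\<Sum>m=1..Suc n. of_real (\<Sum>k=m..Suc n. kern (Suc n) k * v k m) * pf_term c (tl z) m)"
      by (simp only: sum_distrib_left sum_triangle_swap of_real_sum sum_distrib_right of_real_mult mult.assoc)
    also have "\<dots> = (\<Sum>m=1..Suc n. of_real (kern (Suc n) m * (2 * real n + 1)\<^sup>2 / (2 * real n + 1) ^ x) * pf_term c (tl z) m)"
    proof (intro sum.cong refl)
      fix m assume "m \<in> {1..Suc n}"
      hence "(\<Sum>k=m..Suc n. kern (Suc n) k * v k m) = kern (Suc n) m * (2 * real (Suc n) - 1)\<^sup>2 / (2 * real (Suc n) - 1) ^ x"
        unfolding v_def using x by (intro sum_kern_Vsharp) auto
      thus "of_real (\<Sum>k=m..Suc n. kern (Suc n) k * v k m) * pf_term c (tl z) m =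
            of_real (kern (Suc n) m * (2 * real n + 1)\<^sup>2 / (2 * real n + 1) ^ x) * pf_term c (tl z) m"
        by (simp add: algebra_simps del: kern.simps)
    qed
    also have "\<dots> / of_real (2 * real n + 1) ^ 2 = (\<Sum>m=1..Suc n. of_real (kern (Suc n) m) * pf_term c (tl z) m) / of_real (2 * real n + 1) ^ x"
      unfolding sum_divide_distrib using n
      by (intro sum.cong) (simp_all del: kern.simps of_real_add)
    also have "\<dots> = G_upto (Suc n) c (tl z) / of_real (2 * real n + 1) ^ x"
      by (subst Cons.IH[OF tl]) (use Cons.prems in auto)
    finally have "(\<Sum>k=1..Suc n. of_real (kern (Suc n) k) * pf_term (x # c) z k) * u =
        G_upto n (x # c) z + G_upto (Suc n) c (tl z) / of_real (2 * real n + 1) ^ x"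
      unfolding Suc.IH by (simp only: diff_eq_eq add.commute)
    thus ?case unfolding G_upto.simps u_def [symmetric] nonzero_divide_eq_eq[OF u] by (rule sym)
  qed auto
qed

section \<open>The right-hand side as a single sum\<close>

definition rhs_factor :: "nat \<Rightarrow> nat \<Rightarrow> nat \<Rightarrow> complex \<Rightarrow> nat \<Rightarrow> complex" where
  "rhs_factor p e x w k =
     (-1) ^ (k * (delta e + delta x)) * (complex_of_real (2 * real k - 1)) powi (int (delta e + delta x) - 1) /
     ((complex_of_real (2 * real k - 1)) ^ 2 - w ^ 2) * complex_of_real (Vsharp p k (replicate (e - 3) 1))"

text \<open>
  The product in \<open>rhs_term\<close> with arbitrary \<open>c\<^sub>0 = e\<close> and \<open>k\<^sub>-\<^sub>1 = p\<close>, so that its tail has the same form.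
\<close>

definition rhs_gen :: "nat \<Rightarrow> nat \<Rightarrow> nat list \<Rightarrow> complex list \<Rightarrow> nat list \<Rightarrow> complex" where
  "rhs_gen e p c z k = (\<Prod>i\<le>length c.
     rhs_factor ((p # k) ! i) ((e # c @ [0]) ! i) ((e # c @ [0]) ! Suc i) (z ! i) (k ! i))"

lemma rhs_term_eq_rhs_gen: "rhs_term c z k = rhs_gen 1 0 c z k"
proof -
  have c: "c_ext c i = (1 # c @ [0]) ! i" if "i \<le> Suc (length c)" for i
    using that by (cases i) (auto simp: c_ext_def nth_append)
  have k: "k_prev k i = (0 # k) ! i" for i
    by (cases i) (auto simp: k_prev_def)
  show ?thesis
    unfolding rhs_term_def rhs_gen_def rhs_factor_def delta_i_def
    by (intro prod.cong refl) (simp add: c k)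
qed

lemma rhs_gen_Nil: "rhs_gen e p [] [w] [k] = rhs_factor p e 0 w k"
  by (simp add: rhs_gen_def)

lemma rhs_gen_Cons:
  "rhs_gen e p (x # c) (w # z) (k # l) = rhs_factor p e x w k * rhs_gen x k c z l"
  unfolding rhs_gen_def by (simp add: prod.atMost_Suc_shift del: prod.atMost_Suc)

text \<open>The exponent is split between the two neighbours: the part with \<open>delta e\<close>
  joins \<open>Vsharp\<close> in the gap to the left, the part with \<open>delta x\<close> belongs
  to the gap to the right, as in \<open>pf_term\<close>.\<close>

lemma rhs_factor_eq:
  "rhs_factor p e x w k =
     of_real (((-1) ^ k * (2 * real k - 1)) ^ delta e * Vsharp p k (replicate (e - 3) 1)) *
     (of_real (((-1) ^ k * (2 * real k - 1)) ^ delta x / (2 * real k - 1)) / (of_real (2 * real k - 1) ^ 2 - w\<^sup>2))"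
proof -
  define N where "N = complex_of_real (2 * real k - 1)"
  have N: "N \<noteq> 0"
    unfolding N_def of_real_eq_0_iff by (rule odd_real_neq_0)
  have "(-1) ^ (k * (delta e + delta x)) * N powi (int (delta e + delta x) - 1) =
        ((-1) ^ k * N) ^ delta e * (((-1) ^ k * N) ^ delta x / N)"
    using N by (simp add: power_int_diff power_mult power_add power_mult_distrib flip: of_nat_add)
  hence "rhs_factor p e x w k = ((-1) ^ k * N) ^ delta e * (((-1) ^ k * N) ^ delta x / N) / (N\<^sup>2 - w\<^sup>2) *
           complex_of_real (Vsharp p k (replicate (e - 3) 1))"
    by (simp only: rhs_factor_def N_def)
  moreover have "complex_of_real (((-1) ^ k * (2 * real k - 1)) ^ j) = ((-1) ^ k * N) ^ j" for j
    by (simp add: N_def)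
  ultimately show ?thesis
    unfolding N_def [symmetric] by (simp only: of_real_mult of_real_divide N_def [symmetric]) (simp add: mult_ac)
qed

text \<open>Once the first index \<open>k\<close> is fixed, the tail has the same form with
  \<open>e\<close>, \<open>p\<close>, \<open>N\<close> replaced by \<open>x\<close>,
  \<open>k\<close>, \<open>k\<close>; hence the generality in these.\<close>

lemma sum_rhs_gen:
  assumes "length z = length c + 1"
  shows   "(\<Sum>k\<in>chain_idx (length c + 1) 1 N. rhs_gen e p c z k) =
           (\<Sum>k=1..N. of_real (((-1) ^ k * (2 * real k - 1)) ^ delta e * Vsharp p k (replicate (e - 3) 1)) * pf_term c z k)"
  using assms
proof (induction c arbitrary: e p z N)
  case Nil
  then obtain w where z: "z = [w]" by (cases z) auto
  \<comment> \<open>The closing entry 0 has \<open>delta 0 = 2\<close>, which produces the numerator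
    of \<open>pf_term []\<close>.\<close>
  have "((-1) ^ k * (2 * real k - 1)) ^ delta 0 / (2 * real k - 1) = 2 * real k - 1" for k
    using odd_real_neq_0[of k] by (simp add: delta_def power_mult_distrib) (simp add: power2_eq_square)
  thus ?case
    by (simp add: z sum_chain_idx_Suc chain_idx_0 rhs_gen_Nil rhs_factor_eq del: of_real_mult of_real_divide of_real_diff)
next
  case (Cons x c)
  then obtain w z' where z: "z = w # z'" and z': "length z' = length c + 1" by (cases z) auto
  have "(\<Sum>k\<in>chain_idx (length (x # c) + 1) 1 N. rhs_gen e p (x # c) z k) =
        (\<Sum>k=1..N. rhs_factor p e x w k * (\<Sum>l\<in>chain_idx (length c + 1) 1 k. rhs_gen x k c z' l))"
    by (simp add: z sum_chain_idx_Suc rhs_gen_Cons sum_distrib_left del: One_nat_def)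
  also have "\<dots> = (\<Sum>k=1..N. of_real (((-1) ^ k * (2 * real k - 1)) ^ delta e * Vsharp p k (replicate (e - 3) 1)) * pf_term (x # c) z k)"
  proof (intro sum.cong refl)
    fix k
    show "rhs_factor p e x w k * (\<Sum>l\<in>chain_idx (length c + 1) 1 k. rhs_gen x k c z' l) =
          of_real (((-1) ^ k * (2 * real k - 1)) ^ delta e * Vsharp p k (replicate (e - 3) 1)) * pf_term (x # c) z k"
      unfolding Cons.IH[OF z'] rhs_factor_eq pf_term.simps mult.assoc
      by (simp add: z sum_distrib_left sum_distrib_right sum_divide_distrib mult_ac)
  qed
  finally show ?case .
qed

lemma rhs_idx_eq_chain_idx: "rhs_idx d N = chain_idx (d + 1) 1 N"
proof (intro equalityI subsetI)
  fix k assume k: "k \<in> rhs_idx d N"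
  then obtain k0 k' where "k = k0 # k'" by (cases k) (auto simp: rhs_idx_def)
  with k show "k \<in> chain_idx (d + 1) 1 N"
    by (fastforce simp: rhs_idx_def chain_idx_def)
next
  fix k assume k: "k \<in> chain_idx (d + 1) 1 N"
  then obtain k0 k' where "k = k0 # k'" by (cases k) (auto simp: chain_idx_def)
  with k show "k \<in> rhs_idx d N"
    by (auto simp: rhs_idx_def chain_idx_def)
qed

text \<open>By the conventions for \<open>c_0\<close> and \<open>k_{-1}\<close>, the remaining
  factor is \<open>(-1)^k * (2 * k - 1)\<close> times
  \<open>Vsharp 0 k [] = -2 / (2 * k - 1)\<close>.\<close>

lemma sum_rhs_term:
  assumes "length z = length c + 1"
  shows   "(\<Sum>k\<in>rhs_idx (length c) N. rhs_term c z k) = (\<Sum>k=1..N. - 2 * (-1) ^ k * pf_term c z k)"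
proof -
  have "((-1) ^ k * (2 * real k - 1)) ^ delta 1 * Vsharp 0 k (replicate (1 - 3) 1) = - 2 * (-1) ^ k" if "k \<ge> 1" for k
    using that odd_real_neq_0[of k] by (simp add: delta_def Vsharp_def tri_def)
  hence "(\<Sum>k=1..N. of_real (((-1) ^ k * (2 * real k - 1)) ^ delta 1 * Vsharp 0 k (replicate (1 - 3) 1)) * pf_term c z k) =
         (\<Sum>k=1..N. of_real (- 2 * (-1) ^ k) * pf_term c z k)"
    by (intro sum.cong) (simp_all only: atLeastAtMost_iff)
  also have "\<dots> = (\<Sum>k=1..N. - 2 * (-1) ^ k * pf_term c z k)" by simp
  finally show ?thesis
    unfolding rhs_idx_eq_chain_idx rhs_term_eq_rhs_gen sum_rhs_gen[OF assms] .
qed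

section \<open>Passing to the limit\<close>

definition odd_harm :: "nat \<Rightarrow> real" where
  "odd_harm k = (\<Sum>l=1..k. 1 / (2 * real l - 1))"

lemma odd_harm_mono: "k \<le> l \<Longrightarrow> odd_harm k \<le> odd_harm l"
  unfolding odd_harm_def by (intro sum_mono2) auto

lemma odd_harm_ge_1: "1 \<le> k \<Longrightarrow> 1 \<le> odd_harm k"
  using odd_harm_mono[of 1 k] by (simp add: odd_harm_def)

lemma sum_reciprocal_odd_le_odd_harm:
  assumes "1 \<le> m"
  shows "(\<Sum>l=m..k. 1 / (2 * real l - 1)) \<le> odd_harm k"
  unfolding odd_harm_def using assms by (intro sum_mono2) auto

lemma odd_harm_le_ln: "1 \<le> k \<Longrightarrow> odd_harm k \<le> 1 + ln (real k)"
proof (induction k rule: nat_induct_at_least)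
  case base
  show ?case by (simp add: odd_harm_def)
next
  case (Suc k)
  have "ln (real k / real (Suc k)) \<le> real k / real (Suc k) - 1"
    using Suc.hyps by (intro ln_le_minus_one) auto
  also have "\<dots> \<le> - (1 / (2 * real (Suc k) - 1))"
    using Suc.hyps by (simp add: field_simps)
  also have "ln (real k / real (Suc k)) = ln (real k) - ln (real (Suc k))"
    using Suc.hyps by (subst ln_div) auto
  finally show ?case
    using Suc.IH by (simp add: odd_harm_def)
qed

text \<open>A power of the logarithm is absorbed by \<open>k^(1/2)\<close>, which leaves the
  convergent series of \<open>k^(-3/2)\<close>.\<close>

lemma summable_odd_harm_power:
  "summable (\<lambda>k. odd_harm (Suc k) ^ p / (2 * real (Suc k) - 1)\<^sup>2)"
proof (rule summable_comparison_test)
  have "(\<lambda>k. (1 + ln (real k)) powr real p / (2 * real k - 1)\<^sup>2) \<in> O(\<lambda>k. real k powr (-3/2))"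
    by real_asymp
  hence "summable (\<lambda>k. (1 + ln (real k)) powr real p / (2 * real k - 1)\<^sup>2)"
    by (rule summable_comparison_test_bigo[rotated]) (simp add: summable_real_powr_iff)
  thus "summable (\<lambda>k. (1 + ln (real (Suc k))) powr real p / (2 * real (Suc k) - 1)\<^sup>2)"
    by (rule iffD2[OF summable_Suc_iff[of "\<lambda>k. (1 + ln (real k)) powr real p / (2 * real k - 1)\<^sup>2"]])
  have "norm (odd_harm (Suc k) ^ p / (2 * real (Suc k) - 1)\<^sup>2) \<le>
        (1 + ln (real (Suc k))) powr real p / (2 * real (Suc k) - 1)\<^sup>2" for k
  proof -
    have "0 \<le> odd_harm (Suc k)" "odd_harm (Suc k) \<le> 1 + ln (real (Suc k))" "1 + ln (real (Suc k)) > 0"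
      using odd_harm_ge_1[of "Suc k"] odd_harm_le_ln[of "Suc k"] ln_ge_zero[of "real (Suc k)"] by linarith+
    thus ?thesis
      by (simp add: powr_realpow divide_right_mono power_mono del: of_nat_Suc)
  qed
  thus "\<exists>N. \<forall>k\<ge>N. norm (odd_harm (Suc k) ^ p / (2 * real (Suc k) - 1)\<^sup>2) \<le>
        (1 + ln (real (Suc k))) powr real p / (2 * real (Suc k) - 1)\<^sup>2" by blast
qed

lemma chain_sum_nonneg: "1 \<le> m \<Longrightarrow> 0 \<le> chain_sum r k m"
  by (induction r arbitrary: k) (auto intro!: sum_nonneg mult_nonneg_nonneg)

text \<open>Each of the \<open>r\<close> summations costs a factor 2 for the weight and one
  \<open>odd_harm k\<close>; the closing weight costs another 2.\<close>

lemma chain_sum_le: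
  assumes "1 \<le> m" "m \<le> k"
  shows   "chain_sum r k m \<le> 2 ^ Suc r * odd_harm k ^ r"
  using assms(2)
proof (induction r arbitrary: k)
  case 0
  show ?case by (simp add: tri_def)
next
  case (Suc r)
  have h: "1 \<le> odd_harm k" using assms Suc.prems by (intro odd_harm_ge_1) simp
  have "chain_sum (Suc r) k m \<le> (\<Sum>l=m..k. 2 / (2 * real l - 1) * (2 ^ Suc r * odd_harm k ^ r))"
    unfolding chain_sum.simps
  proof (intro sum_mono mult_mono)
    fix l assume l: "l \<in> {m..k}"
    have "chain_sum r l m \<le> 2 ^ Suc r * odd_harm l ^ r" using l by (intro Suc.IH) auto
    also have "\<dots> \<le> 2 ^ Suc r * odd_harm k ^ r"
      using l assms odd_harm_ge_1[of l] by (intro mult_left_mono power_mono odd_harm_mono) auto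
    finally show "chain_sum r l m \<le> 2 ^ Suc r * odd_harm k ^ r" .
    show "2 ^ tri k l / (2 * real l - 1) \<le> 2 / (2 * real l - 1)"
      using l assms by (intro divide_right_mono) (auto simp: tri_def)
  qed (use assms in \<open>auto intro: chain_sum_nonneg\<close>)
  also have "\<dots> = (\<Sum>l=m..k. 1 / (2 * real l - 1)) * (2 ^ Suc (Suc r) * odd_harm k ^ r)"
    by (simp add: sum_distrib_right mult.assoc)
  also have "\<dots> \<le> odd_harm k * (2 ^ Suc (Suc r) * odd_harm k ^ r)"
    using assms h by (intro mult_right_mono sum_reciprocal_odd_le_odd_harm) auto
  finally show ?case by (simp add: mult_ac)
qed

lemma norm_odd_square_minus_ge:
  fixes w :: complex
  assumes "norm w < 1" "1 \<le> k"
  shows   "(1 - norm w ^ 2) * (2 * real k - 1)\<^sup>2 \<le> norm (of_real (2 * real k - 1) ^ 2 - w\<^sup>2)"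
proof -
  have "norm w ^ 2 * 1 \<le> norm w ^ 2 * (2 * real k - 1)\<^sup>2"
    using assms by (intro mult_left_mono) auto
  moreover have "norm (of_real (2 * real k - 1) ^ 2 :: complex) - norm (w\<^sup>2) \<le> norm (of_real (2 * real k - 1) ^ 2 - w\<^sup>2)"
    by (rule norm_triangle_ineq2)
  ultimately show ?thesis
    by (simp only: norm_power norm_of_real power2_abs left_diff_distrib mult_1 mult_1_right)
qed

lemma norm_divide_odd_square_minus_le:
  fixes w :: complex
  assumes "norm w < 1" "1 \<le> k" "norm a \<le> B"
  shows   "norm (a / (of_real (2 * real k - 1) ^ 2 - w\<^sup>2)) \<le> B / (1 - norm w ^ 2) / (2 * real k - 1)\<^sup>2"
proof -
  have "norm w ^ 2 < 1" using assms(1) by (simp add: power_less_one_iff)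
  hence "norm a / norm (of_real (2 * real k - 1) ^ 2 - w\<^sup>2) \<le> B / ((1 - norm w ^ 2) * (2 * real k - 1)\<^sup>2)"
    using assms order.trans[OF norm_ge_zero assms(3)] by (intro frac_le norm_odd_square_minus_ge mult_pos_pos) auto
  thus ?thesis by (simp only: norm_divide divide_divide_eq_left)
qed

text \<open>Further powers of \<open>odd_harm\<close> come from \<open>chain_sum\<close> and from
  the sum over \<open>m\<close>. For \<open>x \<ge> 3\<close> the decay is quadratic up to these
  powers; for \<open>x = 1\<close> the factor from \<open>delta\<close> spends one power of
  \<open>2 * k - 1\<close>.\<close>

lemma norm_pf_term_Cons_le:
  assumes w: "norm (hd z) < 1" and x: "1 \<le> x" "x \<noteq> 2" and K: "0 \<le> K"
    and bound: "\<And>m. 1 \<le> m \<Longrightarrow> norm (pf_term c (tl z) m) \<le> K * odd_harm m ^ p / (2 * real m - 1)"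
    and k: "1 \<le> k"
  shows "norm (pf_term (x # c) z k) \<le> 2 ^ Suc (x - 3) * K / (1 - norm (hd z) ^ 2) * odd_harm k ^ (x - 3 + Suc p) /
           (2 * real k - 1) ^ (if x = 1 then 1 else 2)"
proof -
  define r where "r = x - 3"
  define v where "v = (\<lambda>m. ((-1) ^ k * (2 * real k - 1)) ^ delta x / (2 * real k - 1) *
              Vsharp k m (replicate r 1) * ((-1) ^ m * (2 * real m - 1)) ^ delta x)"
  define q where "q = (if x = 1 then 2 * real k - 1 else 1)"
  have q: "q > 0" using k by (auto simp: q_def)
  have h: "1 \<le> odd_harm k" using k by (rule odd_harm_ge_1)
  have v: "\<bar>v m\<bar> * (K * odd_harm m ^ p / (2 * real m - 1)) \<le>
           (2 ^ Suc r * odd_harm k ^ r * K * odd_harm k ^ p * q) * (1 / (2 * real m - 1))"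
    if m: "m \<in> {1..k}" for m
  proof -
    have C: "0 \<le> chain_sum r k m" "chain_sum r k m \<le> 2 ^ Suc r * odd_harm k ^ r"
      using m by (auto intro!: chain_sum_nonneg chain_sum_le simp del: power_Suc)
    have v_eq: "\<bar>v m\<bar> = q * chain_sum r k m / (if x = 1 then 1 else 2 * real m - 1)"
    proof (cases "x = 1")
      case True
      thus ?thesis using m C odd_real_neq_0[of k] odd_real_neq_0[of m] unfolding v_def
        by (subst Vsharp_replicate) (auto simp: delta_def q_def abs_mult power_abs simp del: One_nat_def)
    next
      case False
      hence "delta x = 0" using x by (auto simp: delta_def)
      with False show ?thesis using m C odd_real_neq_0[of k] odd_real_neq_0[of m] unfolding v_def
        by (subst Vsharp_replicate) (auto simp: q_def abs_mult simp del: One_nat_def)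
    qed
    also have "\<dots> \<le> q * chain_sum r k m / 1"
      using m C q by (intro divide_left_mono) auto
    also have "\<dots> \<le> q * (2 ^ Suc r * odd_harm k ^ r)"
      using C q by simp
    finally have "\<bar>v m\<bar> \<le> q * (2 ^ Suc r * odd_harm k ^ r)" .
    moreover have "odd_harm m ^ p \<le> odd_harm k ^ p"
      using m odd_harm_ge_1[of m] by (intro power_mono odd_harm_mono) auto
    hence "K * odd_harm m ^ p / (2 * real m - 1) \<le> K * odd_harm k ^ p / (2 * real m - 1)"
      using m K by (intro divide_right_mono mult_left_mono) auto
    ultimately have "\<bar>v m\<bar> * (K * odd_harm m ^ p / (2 * real m - 1)) \<le>
        (q * (2 ^ Suc r * odd_harm k ^ r)) * (K * odd_harm k ^ p / (2 * real m - 1))"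
      using m K q h odd_harm_ge_1[of m] by (intro mult_mono) auto
    thus ?thesis by (simp add: mult_ac)
  qed
  have "norm (\<Sum>m=1..k. of_real (v m) * pf_term c (tl z) m) \<le>
        (\<Sum>m=1..k. \<bar>v m\<bar> * (K * odd_harm m ^ p / (2 * real m - 1)))"
  proof (intro sum_norm_le)
    fix m assume "m \<in> {1..k}"
    thus "norm (of_real (v m) * pf_term c (tl z) m) \<le> \<bar>v m\<bar> * (K * odd_harm m ^ p / (2 * real m - 1))"
      unfolding norm_mult norm_of_real by (intro mult_left_mono bound) auto
  qed
  also have "\<dots> \<le> (\<Sum>m=1..k. (2 ^ Suc r * odd_harm k ^ r * K * odd_harm k ^ p * q) * (1 / (2 * real m - 1)))"
    by (intro sum_mono v)
  also have "\<dots> = 2 ^ Suc r * K * odd_harm k ^ (r + Suc p) * q"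
    by (simp only: sum_distrib_left [symmetric] odd_harm_def [symmetric]) (simp add: power_add)
  finally have "norm (pf_term (x # c) z k) \<le>
      2 ^ Suc r * K * odd_harm k ^ (r + Suc p) * q / (1 - norm (hd z) ^ 2) / (2 * real k - 1)\<^sup>2"
    unfolding pf_term.simps v_def r_def by (intro norm_divide_odd_square_minus_le w k)
  also have "\<dots> = 2 ^ Suc r * K / (1 - norm (hd z) ^ 2) * odd_harm k ^ (r + Suc p) * (q / (2 * real k - 1)\<^sup>2)"
    by simp
  also have "q / (2 * real k - 1)\<^sup>2 = 1 / (2 * real k - 1) ^ (if x = 1 then 1 else 2)"
    using odd_real_neq_0[of k] by (simp add: q_def power2_eq_square)
  finally show ?thesis by (simp add: r_def)
qed

text \<open>Linear decay up to logarithms holds even for a leading 1, and it suffices as induction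
  hypothesis: summing it over the next index costs only one more power of
  \<open>odd_harm\<close>.\<close>

lemma pf_term_bound:
  assumes "length z = length c + 1" "\<forall>w\<in>set z. norm w < 1" "\<forall>x\<in>set c. 1 \<le> x \<and> x \<noteq> 2"
  shows   "\<exists>K\<ge>0. \<exists>p. \<forall>k\<ge>1. norm (pf_term c z k) \<le> K * odd_harm k ^ p / (2 * real k - 1)"
  using assms
proof (induction c arbitrary: z)
  case Nil
  hence z: "norm (hd z) < 1" by (cases z) auto
  hence z2: "norm (hd z) ^ 2 < 1" by (simp add: power_less_one_iff)
  have "norm (pf_term [] z k) \<le> 1 / (1 - norm (hd z) ^ 2) / (2 * real k - 1)" if k: "k \<ge> 1" for k
  proof -
    have "norm (pf_term [] z k) \<le> (2 * real k - 1) / (1 - norm (hd z) ^ 2) / (2 * real k - 1)\<^sup>2"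
      unfolding pf_term.simps using k by (intro norm_divide_odd_square_minus_le z) (auto simp: norm_of_real simp del: of_real_diff)
    thus ?thesis using odd_real_neq_0[of k] by (simp add: power2_eq_square)
  qed
  thus ?case using z2
    by (intro exI[of _ "1 / (1 - norm (hd z) ^ 2)"] conjI exI[of _ 0]) auto
next
  case (Cons x c)
  have z: "norm (hd z) < 1" using Cons.prems by (cases z) auto
  hence z2: "norm (hd z) ^ 2 < 1" by (simp add: power_less_one_iff)
  have tl: "length (tl z) = length c + 1" "\<forall>w\<in>set (tl z). norm w < 1"
    using Cons.prems by (cases z; auto)+
  from Cons.IH[OF tl] Cons.prems obtain K p where K: "K \<ge> 0"
    "\<And>m. m \<ge> 1 \<Longrightarrow> norm (pf_term c (tl z) m) \<le> K * odd_harm m ^ p / (2 * real m - 1)" by auto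
  define K' where "K' = 2 ^ Suc (x - 3) * K / (1 - norm (hd z) ^ 2)"
  have K': "K' \<ge> 0" using K z2 by (auto simp: K'_def)
  have "norm (pf_term (x # c) z k) \<le> K' * odd_harm k ^ (x - 3 + Suc p) / (2 * real k - 1)" if k: "k \<ge> 1" for k
  proof -
    have "norm (pf_term (x # c) z k) \<le> K' * odd_harm k ^ (x - 3 + Suc p) / (2 * real k - 1) ^ (if x = 1 then 1 else 2)"
      unfolding K'_def using Cons.prems K k z by (intro norm_pf_term_Cons_le) auto
    also have "\<dots> \<le> K' * odd_harm k ^ (x - 3 + Suc p) / (2 * real k - 1) ^ 1"
      using K' k odd_harm_ge_1[of k] by (intro divide_left_mono power_increasing mult_nonneg_nonneg) auto
    finally show ?thesis by simp
  qed
  with K' show ?case by blast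
qed

lemma summable_norm_pf_term:
  assumes "length z = length c + 1" "\<forall>w\<in>set z. norm w < 1" "\<forall>x\<in>set c. 1 \<le> x \<and> x \<noteq> 2"
    and "c \<noteq> []" "3 \<le> hd c"
  shows   "summable (\<lambda>k. norm (pf_term c z (Suc k)))"
proof -
  obtain x c' where c: "c = x # c'" using assms by (cases c) auto
  have z: "norm (hd z) < 1" using assms by (cases z) auto
  have tl: "length (tl z) = length c' + 1" "\<forall>w\<in>set (tl z). norm w < 1"
    using assms c by (cases z; auto)+
  from pf_term_bound[OF tl] assms c obtain K p where K: "K \<ge> 0"
    "\<And>m. m \<ge> 1 \<Longrightarrow> norm (pf_term c' (tl z) m) \<le> K * odd_harm m ^ p / (2 * real m - 1)" by auto
  define K' where "K' = 2 ^ Suc (x - 3) * K / (1 - norm (hd z) ^ 2)"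
  have "norm (pf_term c z k) \<le> K' * odd_harm k ^ (x - 3 + Suc p) / (2 * real k - 1) ^ (if x = 1 then 1 else 2)"
    if "k \<ge> 1" for k
    unfolding K'_def c using assms c K that z by (intro norm_pf_term_Cons_le) auto
  from this[of "Suc k" for k] have "norm (pf_term c z (Suc k)) \<le> K' * (odd_harm (Suc k) ^ (x - 3 + Suc p) / (2 * real (Suc k) - 1)\<^sup>2)" for k
    using assms(5) c by (simp del: pf_term.simps power_Suc of_nat_Suc split: if_splits)
  thus ?thesis
    by (intro summable_comparison_test[OF _ summable_mult[OF summable_odd_harm_power[of "x - 3 + Suc p"], of K']])
       (auto simp del: power_Suc of_nat_Suc)
qed

text \<open>Tannery's theorem, with \<open>kern\<close> dominated by a bound on
  \<open>wallis_part\<close>. The limit is existential, since it only matters that both sequences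
  share it.\<close>

lemma kern_sum_LIMSEQ:
  fixes f :: "nat \<Rightarrow> complex"
  assumes "summable (\<lambda>k. norm (f (Suc k)))"
  shows   "\<exists>L. (\<lambda>n. \<Sum>k=1..n. of_real (kern n k) * f k) \<longlonglongrightarrow> L \<and>
               (\<lambda>n. \<Sum>k=1..n. of_real (- (4 / pi) * (-1) ^ k) * f k) \<longlonglongrightarrow> L"
proof -
  define a where "a = (\<lambda>k n. of_real (kern n (Suc k)) * f (Suc k))"
  define b where "b = (\<lambda>k. of_real (- (4 / pi) * (-1) ^ Suc k) * f (Suc k))"
  have "Bseq wallis_part" using wallis_part_LIMSEQ by (intro convergent_imp_Bseq convergentI)
  then obtain C where C: "\<And>n. \<bar>wallis_part n\<bar> \<le> C" by (auto simp: Bseq_def)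
  have *: "summable (\<lambda>k. norm (b k)) \<and> (\<lambda>n. suminf (\<lambda>k. a k n)) \<longlonglongrightarrow> suminf b"
  proof (rule conjunct2[OF tannerys_theorem[where M = "\<lambda>k. C * norm (f (Suc k))"]])
    show "(\<lambda>n. a k n) \<longlonglongrightarrow> b k" for k
      unfolding a_def b_def by (intro tendsto_mult tendsto_of_real kern_LIMSEQ tendsto_const)
    have "norm (a k n) \<le> C * norm (f (Suc k))" for k n
      unfolding a_def norm_mult norm_of_real
      using abs_kern_le[of n "Suc k"] C[of n] by (intro mult_right_mono) auto
    thus "eventually (\<lambda>(k, n). norm (a k n) \<le> C * norm (f (Suc k))) (at_top \<times>\<^sub>F sequentially)"
      by (intro always_eventually) auto
    show "summable (\<lambda>k. C * norm (f (Suc k)))"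
      using assms by (rule summable_mult)
  qed auto
  \<comment> \<open>\<open>kern n k\<close> vanishes for \<open>k > n\<close>, so the series is the
    finite sum, shifted by one index.\<close>
  have "suminf (\<lambda>k. a k n) = (\<Sum>k=1..n. of_real (kern n k) * f k)" for n
  proof -
    have "suminf (\<lambda>k. a k n) = (\<Sum>k<n. a k n)"
      by (rule suminf_finite) (auto simp: a_def kern_eq_0 simp del: kern.simps)
    thus ?thesis by (simp only: a_def sum.atLeast1_atMost_eq One_nat_def)
  qed
  with * have "(\<lambda>n. \<Sum>k=1..n. of_real (kern n k) * f k) \<longlonglongrightarrow> suminf b"
    by simp
  moreover have "(\<lambda>n. \<Sum>k<n. b k) \<longlonglongrightarrow> suminf b"
    using * by (intro summable_LIMSEQ[OF summable_norm_cancel]) auto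
  hence "(\<lambda>n. \<Sum>k=1..n. of_real (- (4 / pi) * (-1) ^ k) * f k) \<longlonglongrightarrow> suminf b"
    by (simp only: b_def sum.atLeast1_atMost_eq One_nat_def)
  ultimately show ?thesis by blast
qed

text \<open>Leibniz' series for \<open>pi / 4\<close>; the shift of the starting index from 0 to 1
  absorbs the minus sign.\<close>

lemma Leibniz_LIMSEQ: "(\<lambda>n. \<Sum>k=1..n. - (4 / pi) * (-1) ^ k / (2 * real k - 1)) \<longlonglongrightarrow> 1"
proof -
  have "summable (\<lambda>k. (-1) ^ k * (1 / real (k * 2 + 1) * 1 ^ (k * 2 + 1)))"
    by (rule summable_arctan_series) auto
  hence "(\<lambda>n. \<Sum>k<n. (-1) ^ k * 1 / real (k * 2 + 1)) \<longlonglongrightarrow> pi / 4"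
    unfolding pi_series by (intro summable_LIMSEQ) simp
  from tendsto_mult[OF tendsto_const[of "4 / pi"] this]
  have "(\<lambda>n. 4 / pi * (\<Sum>k<n. (-1) ^ k * 1 / real (k * 2 + 1))) \<longlonglongrightarrow> 1" by simp
  moreover have "(\<Sum>k=1..n. - (4 / pi) * (-1) ^ k / (2 * real k - 1)) = 4 / pi * (\<Sum>k<n. (-1) ^ k * 1 / real (k * 2 + 1))" for n
    by (simp add: sum.atLeast1_atMost_eq sum_distrib_left algebra_simps)
  ultimately show ?thesis by simp
qed

lemma G_upto_Nil_0: "G_upto n [] [0] = (1 :: 'a::real_normed_field)"
  by (induction n) auto

text \<open>For non-empty \<open>c\<close> the terms are absolutely summable. For
  \<open>c = []\<close> they decay only like \<open>1 / k\<close>; subtracting the value at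
  \<open>z = 0\<close> leaves an absolutely summable remainder \<open>e\<close>, and the subtracted
  part contributes 1 to both limits, by \<open>G_upto_Nil_0\<close> and
  \<open>Leibniz_LIMSEQ\<close>.\<close>

lemma G_upto_LIMSEQ:
  assumes "length z = length c + 1" "\<forall>w\<in>set z. norm w < 1" "\<forall>x\<in>set c. 1 \<le> x \<and> x \<noteq> 2"
    and "c \<noteq> [] \<longrightarrow> 3 \<le> hd c"
  shows   "\<exists>L. (\<lambda>n. G_upto n c z) \<longlonglongrightarrow> L \<and>
               (\<lambda>n. \<Sum>k=1..n. of_real (- (4 / pi) * (-1) ^ k) * pf_term c z k) \<longlonglongrightarrow> L"
proof (cases "c = []")
  case False
  have "G_upto n c z = (\<Sum>k=1..n. of_real (kern n k) * pf_term c z k)" for n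
    using assms False by (intro G_upto_eq_sum_kern) auto
  thus ?thesis
    using kern_sum_LIMSEQ[of "pf_term c z"] summable_norm_pf_term assms False by simp
next
  case True
  then obtain w where z: "z = [w]" using assms by (cases z) auto
  have w: "norm w < 1" using assms z by simp
  hence w2: "norm w ^ 2 < 1" by (simp add: power_less_one_iff)
  define e where "e = (\<lambda>k. w\<^sup>2 / of_real (2 * real k - 1) / (of_real (2 * real k - 1) ^ 2 - w\<^sup>2))"
  have pf: "pf_term [] z k = pf_term [] [0] k + e k" if "k \<ge> 1" for k
  proof -
    have "N / (N\<^sup>2 - w\<^sup>2) = N / N\<^sup>2 + w\<^sup>2 / N / (N\<^sup>2 - w\<^sup>2)" if "N \<noteq> 0" "N\<^sup>2 \<noteq> w\<^sup>2" for N
      using that by (simp add: divide_simps) (simp add: power2_eq_square algebra_simps)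
    from this[of "of_real (2 * real k - 1)"] odd_square_neq[OF w that] odd_real_neq_0[of k]
    show ?thesis by (simp add: z e_def del: of_real_diff)
  qed
  have "summable (\<lambda>k. norm (e (Suc k)))"
  proof (rule summable_comparison_test)
    \<comment> \<open>The power 0 brings the bound into the form of
      \<open>summable_odd_harm_power\<close>.\<close>
    have "norm (e k) \<le> norm w ^ 2 / (1 - norm w ^ 2) * (odd_harm k ^ 0 / (2 * real k - 1)\<^sup>2)" if "k \<ge> 1" for k
    proof -
      have "norm (w\<^sup>2 / of_real (2 * real k - 1)) \<le> norm w ^ 2 / 1"
        unfolding norm_divide norm_power norm_of_real using that by (intro divide_left_mono) auto
      from norm_divide_odd_square_minus_le[OF w that this] show ?thesis by (simp add: e_def)
    qed
    thus "\<exists>N. \<forall>k\<ge>N. norm (norm (e (Suc k))) \<le> norm w ^ 2 / (1 - norm w ^ 2) * (odd_harm (Suc k) ^ 0 / (2 * real (Suc k) - 1)\<^sup>2)"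
      by (auto simp del: power_0 of_nat_Suc intro!: exI[of _ 0])
    show "summable (\<lambda>k. norm w ^ 2 / (1 - norm w ^ 2) * (odd_harm (Suc k) ^ 0 / (2 * real (Suc k) - 1)\<^sup>2))"
      by (intro summable_mult summable_odd_harm_power)
  qed
  from kern_sum_LIMSEQ[OF this] obtain L where
    L: "(\<lambda>n. \<Sum>k=1..n. of_real (kern n k) * e k) \<longlonglongrightarrow> L"
       "(\<lambda>n. \<Sum>k=1..n. of_real (- (4 / pi) * (-1) ^ k) * e k) \<longlonglongrightarrow> L" by blast
  have "(\<lambda>n. \<Sum>k=1..n. of_real (kern n k) * pf_term [] z k) \<longlonglongrightarrow> 1 + L"
  proof (rule Lim_transform_eventually[OF tendsto_add[OF tendsto_const L(1)]])
    show "\<forall>\<^sub>F n in sequentially. 1 + (\<Sum>k=1..n. of_real (kern n k) * e k) = (\<Sum>k=1..n. of_real (kern n k) * pf_term [] z k)"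
      using eventually_ge_at_top[of 1]
    proof eventually_elim
      case (elim n)
      have "(\<Sum>k=1..n. of_real (kern n k) * pf_term [] z k) =
            (\<Sum>k=1..n. of_real (kern n k) * pf_term [] [0] k + of_real (kern n k) * e k)"
        by (intro sum.cong) (auto simp: pf algebra_simps simp del: pf_term.simps)
      also have "\<dots> = (\<Sum>k=1..n. of_real (kern n k) * pf_term [] [0] k) + (\<Sum>k=1..n. of_real (kern n k) * e k)"
        by (rule sum.distrib)
      also have "(\<Sum>k=1..n. of_real (kern n k) * pf_term [] [0] k) = 1"
        using elim by (subst G_upto_eq_sum_kern [symmetric]) (auto simp: G_upto_Nil_0)
      finally show ?case by simp
    qed
  qed
  moreover have "\<forall>\<^sub>F n in sequentially. (\<Sum>k=1..n. of_real (kern n k) * pf_term [] z k) = G_upto n c z"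
    using eventually_ge_at_top[of 1]
    by eventually_elim (use assms True in \<open>simp add: G_upto_eq_sum_kern\<close>)
  ultimately have 1: "(\<lambda>n. G_upto n c z) \<longlonglongrightarrow> 1 + L"
    by (rule Lim_transform_eventually)
  have "(\<lambda>n. complex_of_real (\<Sum>k=1..n. - (4 / pi) * (-1) ^ k / (2 * real k - 1)) +
           (\<Sum>k=1..n. of_real (- (4 / pi) * (-1) ^ k) * e k)) \<longlonglongrightarrow> of_real 1 + L"
    by (intro tendsto_add tendsto_of_real Leibniz_LIMSEQ L(2))
  moreover have "complex_of_real (\<Sum>k=1..n. - (4 / pi) * (-1) ^ k / (2 * real k - 1)) +
           (\<Sum>k=1..n. of_real (- (4 / pi) * (-1) ^ k) * e k) =
           (\<Sum>k=1..n. of_real (- (4 / pi) * (-1) ^ k) * pf_term c z k)" for n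
  proof -
    have "of_real (- (4 / pi) * (-1) ^ k / (2 * real k - 1)) + of_real (- (4 / pi) * (-1) ^ k) * e k =
          of_real (- (4 / pi) * (-1) ^ k) * pf_term c z k" if "k \<ge> 1" for k
    proof -
      have "pf_term [] [0] k = of_real (1 / (2 * real k - 1))"
        using odd_real_neq_0[of k] by (simp add: power2_eq_square)
      thus ?thesis unfolding True pf[OF that] by (simp add: distrib_left)
    qed
    thus ?thesis
      unfolding of_real_sum sum.distrib [symmetric] by (intro sum.cong) auto
  qed
  ultimately show ?thesis using 1 by auto
qed

section \<open>The truncated generating function\<close>

text \<open>\<open>infsetsum\<close> is an integral over the counting measure, so dominated
  convergence for integrals applies; absolute summability carries the result back to
  \<open>infsum\<close>.\<close>

lemma infsum_dominated_convergence:
  fixes f :: "nat \<Rightarrow> 'a \<Rightarrow> 'b::{banach, second_countable_topology}"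
  assumes lim: "\<And>x. x \<in> A \<Longrightarrow> (\<lambda>n. f n x) \<longlonglongrightarrow> g x"
    and bound: "\<And>n x. x \<in> A \<Longrightarrow> norm (f n x) \<le> h x"
    and h: "h summable_on A"
  shows "(\<lambda>n. infsum (f n) A) \<longlonglongrightarrow> infsum g A"
proof -
  have bound_g: "norm (g x) \<le> h x" if "x \<in> A" for x
    using tendsto_norm[OF lim[OF that]] bound[OF that] by (intro LIMSEQ_le_const2) auto
  have summable: "Infinite_Set_Sum.abs_summable_on k A" if "\<And>x. x \<in> A \<Longrightarrow> norm (k x) \<le> h x" for k :: "'a \<Rightarrow> 'b"
    using Infinite_Sum.abs_summable_on_comparison_test'[OF h that] abs_summable_equivalent by blast
  have "Infinite_Set_Sum.abs_summable_on h A"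
    using h summable_on_iff_abs_summable_on_real abs_summable_equivalent by blast
  hence "(\<lambda>n. infsetsum (f n) A) \<longlonglongrightarrow> infsetsum g A"
    unfolding infsetsum_def
    by (intro integral_dominated_convergence[where w = h])
       (auto simp: Infinite_Set_Sum.abs_summable_on_def AE_count_space lim bound)
  thus ?thesis
    using summable bound bound_g by (simp add: infsetsum_infsum)
qed

section \<open>Truncated multiple t-star values\<close>

primrec tstar_upto :: "nat list \<Rightarrow> nat \<Rightarrow> real" where
  "tstar_upto [] n = 1"
| "tstar_upto (x # s) n = (\<Sum>k=1..n. tstar_upto s k / (2 * real k - 1) ^ x)"

lemma tstar_upto_eq_sum:
  "tstar_upto s n = (\<Sum>k\<in>chain_idx (length s) 1 n. \<Prod>j<length s. 1 / (2 * real (k ! j) - 1) ^ (s ! j))"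
proof (induction s arbitrary: n)
  case Nil
  show ?case by (simp add: chain_idx_0)
next
  case (Cons x s)
  show ?case
    by (simp add: sum_chain_idx_Suc prod.lessThan_Suc_shift sum_divide_distrib Cons.IH
             del: prod.lessThan_Suc One_nat_def)
qed

lemma tstar_upto_nonneg: "0 \<le> tstar_upto s n"
  by (induction s arbitrary: n) (auto intro!: sum_nonneg)

lemma tstar_upto_Suc:
  "tstar_upto (x # s) (Suc n) = tstar_upto (x # s) n + tstar_upto s (Suc n) / (2 * real n + 1) ^ x"
  by (simp add: algebra_simps)

text \<open>A finite set of chains is bounded by its largest entry, so the truncations exhaust
  \<open>tstar_idx\<close> along the filter that defines \<open>has_sum\<close>.\<close>

lemma chain_idx_filterlim:
  "filterlim (\<lambda>n. chain_idx r 1 n) (finite_subsets_at_top (tstar_idx r)) sequentially"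
  unfolding filterlim_finite_subsets_at_top
proof safe
  fix X assume X: "finite X" "X \<subseteq> tstar_idx r"
  define m where "m = Max (insert 0 (\<Union>(set ` X)))"
  have "X \<subseteq> chain_idx r 1 n" if "n \<ge> m" for n
  proof
    fix k assume k: "k \<in> X"
    have "x \<le> n" if "x \<in> set k" for x
      using k X(1) that \<open>n \<ge> m\<close> unfolding m_def by (subst (asm) Max_le_iff) auto
    thus "k \<in> chain_idx r 1 n"
      using k X by (auto simp: chain_idx_def tstar_idx_def)
  qed
  moreover have "chain_idx r 1 n \<subseteq> tstar_idx r" for n
    by (auto simp: chain_idx_def tstar_idx_def)
  ultimately show "\<forall>\<^sub>F n in sequentially. finite (chain_idx r 1 n) \<and> X \<subseteq> chain_idx r 1 n \<and> chain_idx r 1 n \<subseteq> tstar_idx r"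
    by (intro eventually_sequentiallyI[of m]) (simp add: finite_chain_idx)
qed

text \<open>The terms are non-negative, so bounded truncations give summability, and
  \<open>tstar s\<close> is the true value rather than the default 0 of
  \<open>infsum\<close>.\<close>

lemma tstar_upto_LIMSEQ:
  assumes "\<And>n. tstar_upto s n \<le> C"
  shows   "(\<lambda>n. tstar_upto s n) \<longlonglongrightarrow> tstar s" and "tstar_upto s n \<le> tstar s"
proof -
  define g where "g = (\<lambda>k. \<Prod>j<length s. 1 / (2 * real (k ! j) - 1) ^ (s ! j))"
  have nonneg: "0 \<le> g k" if "k \<in> tstar_idx (length s)" for k
    unfolding g_def
  proof (intro prod_nonneg)
    fix j assume "j \<in> {..<length s}"
    hence "1 \<le> k ! j" using that by (auto simp: tstar_idx_def)
    thus "0 \<le> 1 / (2 * real (k ! j) - 1) ^ (s ! j)" by simp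
  qed
  have "g summable_on tstar_idx (length s)"
  proof (rule nonneg_bdd_above_summable_on[OF nonneg])
    show "bdd_above (sum g ` {X. X \<subseteq> tstar_idx (length s) \<and> finite X})"
    proof (rule bdd_aboveI2)
      fix X assume "X \<in> {X. X \<subseteq> tstar_idx (length s) \<and> finite X}"
      hence "\<forall>\<^sub>F n in sequentially. finite (chain_idx (length s) 1 n) \<and> X \<subseteq> chain_idx (length s) 1 n \<and> chain_idx (length s) 1 n \<subseteq> tstar_idx (length s)"
        using chain_idx_filterlim[of "length s"] unfolding filterlim_finite_subsets_at_top by auto
      then obtain n where "finite (chain_idx (length s) 1 n)" "X \<subseteq> chain_idx (length s) 1 n" "chain_idx (length s) 1 n \<subseteq> tstar_idx (length s)"
        by (auto simp: eventually_sequentially)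
      hence "sum g X \<le> sum g (chain_idx (length s) 1 n)"
        using nonneg by (intro sum_mono2) auto
      also have "\<dots> \<le> C" using assms[of n] by (simp add: tstar_upto_eq_sum g_def)
      finally show "sum g X \<le> C" .
    qed
  qed
  hence sum: "(g has_sum tstar s) (tstar_idx (length s))"
    by (simp add: tstar_def g_def)
  have eq: "tstar_upto s n = sum g (chain_idx (length s) 1 n)" for n
    by (simp add: tstar_upto_eq_sum g_def)
  show "(\<lambda>n. tstar_upto s n) \<longlonglongrightarrow> tstar s"
    unfolding eq by (rule filterlim_compose[OF sum[unfolded has_sum_def] chain_idx_filterlim])
  show "tstar_upto s n \<le> tstar s"
    unfolding eq using nonneg
    by (intro finite_sum_le_has_sum[OF sum] finite_chain_idx) (auto simp: chain_idx_def tstar_idx_def)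
qed

section \<open>The power series of the truncated values\<close>

definition G_summand :: "nat \<Rightarrow> nat list \<Rightarrow> 'a::real_normed_field list \<Rightarrow> nat list \<Rightarrow> 'a" where
  "G_summand n c z a = of_real (tstar_upto (G_index c a) n) * (\<Prod>i\<le>length c. (z ! i) ^ (2 * (a ! i)))"

lemma G_index_Nil: "G_index [] (a0 # a) = replicate a0 2"
  by (simp add: G_index_def)

lemma G_index_Cons:
  assumes "a \<noteq> []"
  shows   "G_index (x # c) (a0 # a) = replicate a0 2 @ x # G_index c a"
proof -
  have "[1..<length (x # c) + 1] = 1 # map Suc [1..<length c + 1]"
    by (simp add: upt_conv_Cons map_Suc_upt del: upt_Suc)
  moreover have "map (\<lambda>i. (x # c) ! (i - 1) # replicate ((a0 # a) ! i) 2) (map Suc [1..<length c + 1]) =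
                 map (\<lambda>i. c ! (i - 1) # replicate (a ! i) 2) [1..<length c + 1]"
    by (auto simp: nth_Cons')
  ultimately show ?thesis
    by (simp add: G_index_def del: upt_Suc map_map)
qed

lemma G_summand_0:
  assumes "length a = length c"
  shows   "G_summand 0 c z (a0 # a) = (if c = [] \<and> a0 = 0 then 1 else 0)"
proof (cases c)
  case Nil
  thus ?thesis by (cases a0) (auto simp: G_summand_def G_index_Nil)
next
  case (Cons x c')
  hence "a \<noteq> []" using assms by auto
  thus ?thesis using Cons by (cases a0) (auto simp: G_summand_def G_index_Cons)
qed

text \<open>The new chains start with \<open>n + 1\<close>. If \<open>a0 > 0\<close>, their first
  exponent is 2, and removing it lowers \<open>a0\<close>; if \<open>a0 = 0\<close>, it is
  \<open>hd c\<close>, and removing it passes to the tails. For \<open>a0 = 0\<close> and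
  \<open>c = []\<close> the index is empty and nothing is added.\<close>

lemma G_summand_Suc:
  assumes "length z = length c + 1" "length a = length c"
  shows "G_summand (Suc n) c z (a0 # a) = G_summand n c z (a0 # a) +
    (if a0 = 0 then (if c = [] then 0 else G_summand (Suc n) (tl c) (tl z) a / of_real (2 * real n + 1) ^ hd c)
     else (hd z / of_real (2 * real n + 1))\<^sup>2 * G_summand (Suc n) c z ((a0 - 1) # a))"
proof (cases a0)
  case (Suc b)
  have "G_index c (Suc b # a) = 2 # G_index c (b # a)"
  proof (cases c)
    case Nil
    thus ?thesis by (simp add: G_index_Nil)
  next
    case (Cons x c')
    hence "a \<noteq> []" using assms by auto
    thus ?thesis by (simp add: Cons G_index_Cons)
  qed
  moreover have "(\<Prod>i\<le>length c. (z ! i) ^ (2 * ((Suc b # a) ! i))) = (hd z)\<^sup>2 * (\<Prod>i\<le>length c. (z ! i) ^ (2 * ((b # a) ! i)))"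
    using assms(1) by (cases z) (simp_all add: prod.atMost_shift power2_eq_square)
  ultimately show ?thesis
    by (simp add: G_summand_def Suc tstar_upto_Suc power_divide distrib_left distrib_right del: tstar_upto.simps)
next
  case 0
  show ?thesis
  proof (cases c)
    case Nil
    thus ?thesis by (simp add: 0 G_summand_def G_index_Nil)
  next
    case (Cons x c')
    hence "a \<noteq> []" using assms by auto
    moreover obtain w z' where z: "z = w # z'" using assms by (cases z) auto
    ultimately show ?thesis
      by (simp add: 0 Cons G_summand_def G_index_Cons tstar_upto_Suc prod.atMost_Suc_shift distrib_right
               del: tstar_upto.simps prod.atMost_Suc)
  qed
qed

lemma G_upto_Suc:
  assumes "norm (hd z) < 1"
  shows "G_upto (Suc n) c z * (1 - (hd z / of_real (2 * real n + 1))\<^sup>2) = G_upto n c z +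
     (if c = [] then 0 else G_upto (Suc n) (tl c) (tl z) / of_real (2 * real n + 1) ^ hd c)"
  using one_minus_square_neq_0[OF assms, of n] by (cases c) (simp_all del: of_real_add)

definition box_idx :: "nat \<Rightarrow> nat \<Rightarrow> nat list set" where
  "box_idx d M = {a. length a = d \<and> set a \<subseteq> {..M}}"

lemma finite_box_idx: "finite (box_idx d M)"
  unfolding box_idx_def using finite_lists_length_eq[of "{..M}" d] by (simp add: conj_commute)

lemma sum_box_idx_Suc:
  "(\<Sum>a\<in>box_idx (Suc d) M. f a) = (\<Sum>a0\<le>M. \<Sum>a\<in>box_idx d M. f (a0 # a))"
proof -
  have "box_idx (Suc d) M = (\<lambda>(a0, a). a0 # a) ` ({..M} \<times> box_idx d M)"
    by (auto simp: box_idx_def length_Suc_conv image_iff)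
  moreover have "inj_on (\<lambda>(a0, a). a0 # a) A" for A :: "(nat \<times> nat list) set"
    by (auto simp: inj_on_def)
  ultimately show ?thesis
    by (simp add: sum.reindex sum.cartesian_product case_prod_unfold)
qed

lemma G_summand_nonneg:
  fixes z :: "real list"
  assumes "\<forall>w\<in>set z. 0 \<le> w" "length z = length c + 1"
  shows   "0 \<le> G_summand n c z a"
  unfolding G_summand_def using assms
  by (auto intro!: mult_nonneg_nonneg prod_nonneg tstar_upto_nonneg zero_le_power)

text \<open>Summed over a finite box, \<open>G_summand_Suc\<close> yields the recurrence of
  \<open>G_upto\<close> as an inequality, solvable since \<open>w < 1\<close>. Finite boxes avoid
  presupposing summability.\<close>

lemma sum_box_G_summand_le:
  fixes z :: "real list"
  assumes "length z = length c + 1" "\<forall>w\<in>set z. 0 \<le> w \<and> w < 1"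
  shows   "(\<Sum>a\<in>box_idx (length c + 1) M. G_summand n c z a) \<le> G_upto n c z"
  using assms
proof (induction c arbitrary: z n rule: length_induct)
  case (1 c)
  have hd: "0 \<le> hd z" "hd z < 1" using "1.prems" by (cases z; auto)+
  have len: "length a = length c" if "a \<in> box_idx (length c) M" for a
    using that by (simp add: box_idx_def)
  show ?case
  proof (induction n)
    case 0
    show ?case
    proof (cases "c = []")
      case True
      have "box_idx 0 M = {[]}" by (auto simp: box_idx_def)
      thus ?thesis using True by (simp add: sum_box_idx_Suc G_summand_0 sum.delta)
    qed (simp add: sum_box_idx_Suc G_summand_0 len)
  next
    case (Suc n)
    define B where "B = box_idx (length c) M"
    define f where "f = (\<lambda>n a. G_summand n c z a)"
    define w where "w = (hd z / (2 * real n + 1))\<^sup>2"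
    define Q where "Q = (\<lambda>a. if c = [] then 0 else G_summand (Suc n) (tl c) (tl z) a / (2 * real n + 1) ^ hd c)"
    have w: "0 \<le> w" "w < 1"
      using hd unfolding w_def by (auto simp: power_divide divide_less_eq_1 power_less_one_iff intro!: power_strict_mono)
    have nonneg: "0 \<le> f n a" for n a
      unfolding f_def using "1.prems" by (intro G_summand_nonneg) auto
    have Suc_eq: "f (Suc n) (a0 # a) = f n (a0 # a) + (if a0 = 0 then Q a else w * f (Suc n) ((a0 - 1) # a))" if "a \<in> B" for a0 a
      using G_summand_Suc[of z c a n a0] len[of a] that "1.prems" by (simp add: f_def Q_def w_def B_def)
    have Q: "(\<Sum>a\<in>B. Q a) \<le> (if c = [] then 0 else G_upto (Suc n) (tl c) (tl z) / (2 * real n + 1) ^ hd c)"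
    proof (cases "c = []")
      case False
      have "(\<Sum>a\<in>box_idx (length (tl c) + 1) M. G_summand (Suc n) (tl c) (tl z) a) \<le> G_upto (Suc n) (tl c) (tl z)"
        using "1.prems" False by (intro "1.IH"[rule_format]) (auto dest: list.set_sel(2)[rotated])
      thus ?thesis
        using False by (simp add: Q_def B_def sum_divide_distrib [symmetric] divide_right_mono)
    qed (simp add: Q_def)
    have "(\<Sum>a\<in>box_idx (length c + 1) M. f (Suc n) a) =
          (\<Sum>a0\<le>M. \<Sum>a\<in>B. f n (a0 # a) + (if a0 = 0 then Q a else w * f (Suc n) ((a0 - 1) # a)))"
      by (simp add: sum_box_idx_Suc B_def [symmetric] Suc_eq)
    also have "\<dots> = (\<Sum>a\<in>box_idx (length c + 1) M. f n a) + (\<Sum>a\<in>B. Q a) + w * (\<Sum>a0<M. \<Sum>a\<in>B. f (Suc n) (a0 # a))"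
    proof -
      have "(\<Sum>a0\<le>M. \<Sum>a\<in>B. if a0 = 0 then Q a else w * f (Suc n) ((a0 - 1) # a)) =
            (\<Sum>a\<in>B. Q a) + w * (\<Sum>a0<M. \<Sum>a\<in>B. f (Suc n) (a0 # a))"
        by (subst sum.atMost_shift) (simp add: sum_distrib_left)
      thus ?thesis by (simp add: sum_box_idx_Suc B_def [symmetric] sum.distrib)
    qed
    \<comment> \<open>Lowering \<open>a0\<close> by one loses the layer \<open>a0 = M\<close>;
      restoring it only increases the sum of non-negative terms.\<close>
    also have "w * (\<Sum>a0<M. \<Sum>a\<in>B. f (Suc n) (a0 # a)) \<le> w * (\<Sum>a0\<le>M. \<Sum>a\<in>B. f (Suc n) (a0 # a))"
      by (intro mult_left_mono sum_mono2 w) (auto intro: sum_nonneg nonneg)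
    also have "(\<Sum>a0\<le>M. \<Sum>a\<in>B. f (Suc n) (a0 # a)) = (\<Sum>a\<in>box_idx (length c + 1) M. f (Suc n) a)"
      by (simp add: sum_box_idx_Suc B_def)
    finally have "(\<Sum>a\<in>box_idx (length c + 1) M. f (Suc n) a) * (1 - w) \<le>
        (\<Sum>a\<in>box_idx (length c + 1) M. f n a) + (\<Sum>a\<in>B. Q a)"
      by (simp add: algebra_simps)
    also have "\<dots> \<le> G_upto n c z + (if c = [] then 0 else G_upto (Suc n) (tl c) (tl z) / (2 * real n + 1) ^ hd c)"
      using Suc.IH Q unfolding f_def by (intro add_mono) auto
    also have "\<dots> = G_upto (Suc n) c z * (1 - w)"
      using G_upto_Suc[of z n c] hd by (simp add: w_def)
    finally show ?case using w by (simp add: f_def)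
  qed
qed

lemma G_summand_summable_real:
  fixes z :: "real list"
  assumes "length z = length c + 1" "\<forall>w\<in>set z. 0 \<le> w \<and> w < 1"
  shows   "G_summand n c z summable_on {a. length a = length c + 1}"
proof (rule nonneg_bdd_above_summable_on)
  show "0 \<le> G_summand n c z a" for a
    using assms by (intro G_summand_nonneg) auto
  show "bdd_above (sum (G_summand n c z) ` {X. X \<subseteq> {a. length a = length c + 1} \<and> finite X})"
  proof (rule bdd_aboveI2)
    fix X :: "nat list set" assume X: "X \<in> {X. X \<subseteq> {a. length a = length c + 1} \<and> finite X}"
    define M where "M = Max (insert 0 (\<Union>(set ` X)))"
    have "x \<le> M" if "x \<in> set a" "a \<in> X" for x a
      unfolding M_def using that X by (intro Max_ge) auto
    hence "X \<subseteq> box_idx (length c + 1) M" using X by (auto simp: box_idx_def)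
    hence "sum (G_summand n c z) X \<le> (\<Sum>a\<in>box_idx (length c + 1) M. G_summand n c z a)"
      using assms by (intro sum_mono2 finite_box_idx G_summand_nonneg) auto
    also have "\<dots> \<le> G_upto n c z" by (rule sum_box_G_summand_le[OF assms])
    finally show "sum (G_summand n c z) X \<le> G_upto n c z" .
  qed
qed

lemma norm_G_summand:
  assumes "length z = length c + 1"
  shows "norm (G_summand n c z a) = G_summand n c (map norm z) a"
  using assms tstar_upto_nonneg[of "G_index c a" n]
  by (simp add: G_summand_def norm_mult prod_norm [symmetric] norm_power)

text \<open>Absolute summability comes from the real case, so a sum \<open>X\<close> exists; summing
  \<open>G_summand_Suc\<close> over all \<open>a\<close> gives for \<open>X\<close> the linear
  equation that determines \<open>G_upto\<close>.\<close>

lemma G_summand_has_sum: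
  fixes z :: "'a::{real_normed_field, banach} list"
  assumes "length z = length c + 1" "\<forall>w\<in>set z. norm w < 1"
  shows   "(G_summand n c z has_sum G_upto n c z) {a. length a = length c + 1}"
  using assms
proof (induction c arbitrary: z n rule: length_induct)
  case (1 c)
  have hd: "norm (hd z) < 1" using "1.prems" by (cases z) auto
  define A where "A = (\<lambda>d. {a :: nat list. length a = d})"
  have A: "A (length c + 1) = {a. length a = length c + 1}" by (simp add: A_def)
  have A_Suc: "\<exists>a0 a'. a = a0 # a' \<and> length a' = length c" if "a \<in> A (length c + 1)" for a
    using that by (auto simp: A_def length_Suc_conv)
  show ?case
  proof (induction n)
    case 0
    show ?case
    proof (cases "c = []")
      case True
      have "(G_summand 0 c z has_sum 1) {[0]}"
        by (rule has_sum_finiteI) (auto simp: True G_summand_0)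
      moreover have "(G_summand 0 c z has_sum 1) {[0]} \<longleftrightarrow> (G_summand 0 c z has_sum 1) (A (length c + 1))"
        using A_Suc by (intro has_sum_cong_neutral) (auto simp: True G_summand_0 A_def length_Suc_conv split: if_splits)
      ultimately show ?thesis by (simp add: True A_def)
    next
      case False
      have "(G_summand 0 c z has_sum 0) (A (length c + 1))"
        using False by (intro has_sum_0) (auto simp: G_summand_0 A_def length_Suc_conv)
      thus ?thesis using False by (simp add: A_def)
    qed
  next
    case (Suc n)
    define f where "f = (\<lambda>n a. G_summand n c z a)"
    define w where "w = (hd z / of_real (2 * real n + 1))\<^sup>2"
    define Q where "Q = (\<lambda>a. if c = [] then 0 else G_summand (Suc n) (tl c) (tl z) a / of_real (2 * real n + 1) ^ hd c)"
    define q where "q = (if c = [] then 0 else G_upto (Suc n) (tl c) (tl z) / of_real (2 * real n + 1) ^ hd c)"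
    have Suc_eq: "f (Suc n) (a0 # a) = f n (a0 # a) + (if a0 = 0 then Q a else w * f (Suc n) ((a0 - 1) # a))"
      if "length a = length c" for a0 a
      using G_summand_Suc[of z c a n a0] that "1.prems" by (simp add: f_def Q_def w_def)
    have "(\<lambda>a. norm (f (Suc n) a)) summable_on A (length c + 1)"
      unfolding f_def norm_G_summand[OF "1.prems"(1)] A
      using G_summand_summable_real[of "map norm z" c "Suc n"] "1.prems" by simp
    then obtain X where X: "(f (Suc n) has_sum X) (A (length c + 1))"
      using abs_summable_summable by (auto simp: summable_on_def)
    have Q: "(Q has_sum q) (A (length c))"
    proof (cases "c = []")
      case False
      have "(G_summand (Suc n) (tl c) (tl z) has_sum G_upto (Suc n) (tl c) (tl z)) {a. length a = length (tl c) + 1}"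
        using "1.prems" False by (intro "1.IH"[rule_format]) (auto dest: list.set_sel(2)[rotated])
      hence "(G_summand (Suc n) (tl c) (tl z) has_sum G_upto (Suc n) (tl c) (tl z)) (A (length c))"
        using False by (simp add: A_def)
      thus ?thesis
        using False by (simp add: Q_def q_def has_sum_divide_const del: of_real_add)
    qed (simp add: Q_def q_def)
    \<comment> \<open>\<open>g\<close> and \<open>h\<close> are the contributions of
      \<open>a0 = 0\<close> and of \<open>a0 > 0\<close> to the step from \<open>n\<close> to
      \<open>Suc n\<close>.\<close>
    define g where "g = (\<lambda>a. if hd a = 0 then Q (tl a) else 0)"
    define h where "h = (\<lambda>a. if hd a = 0 then 0 else w * f (Suc n) ((hd a - 1) # tl a))"
    have "(g has_sum q) (Cons 0 ` A (length c))"
      by (subst has_sum_reindex) (use Q in \<open>auto simp: g_def o_def\<close>)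
    also have "?this \<longleftrightarrow> (g has_sum q) (A (length c + 1))"
      by (intro has_sum_cong_neutral) (auto simp: g_def A_def length_Suc_conv)
    finally have g: "(g has_sum q) (A (length c + 1))" .
    have inj: "inj_on (\<lambda>a. Suc (hd a) # tl a) (A (length c + 1))"
      by (auto simp: inj_on_def A_def length_Suc_conv)
    have "((h \<circ> (\<lambda>a. Suc (hd a) # tl a)) has_sum w * X) (A (length c + 1)) \<longleftrightarrow> ((\<lambda>a. w * f (Suc n) a) has_sum w * X) (A (length c + 1))"
      by (intro has_sum_cong) (auto simp: h_def A_def length_Suc_conv)
    hence "(h has_sum w * X) ((\<lambda>a. Suc (hd a) # tl a) ` A (length c + 1))"
      using has_sum_cmult_right[OF X, of w] has_sum_reindex[OF inj] by blast
    also have "?this \<longleftrightarrow> (h has_sum w * X) (A (length c + 1))"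
    proof (intro has_sum_cong_neutral)
      fix a assume a: "a \<in> A (length c + 1) - (\<lambda>a. Suc (hd a) # tl a) ` A (length c + 1)"
      then obtain a0 a' where a': "a = a0 # a'" "length a' = length c" using A_Suc by blast
      have "a0 = 0"
      proof (cases a0)
        case (Suc b)
        hence "a = (\<lambda>a. Suc (hd a) # tl a) (b # a')" "b # a' \<in> A (length c + 1)" using a' by (auto simp: A_def)
        with a show ?thesis by blast
      qed
      thus "h a = 0" by (simp add: h_def a')
    qed (auto simp: A_def)
    finally have h: "(h has_sum w * X) (A (length c + 1))" .
    have "(f n has_sum G_upto n c z) (A (length c + 1))"
      using Suc.IH by (simp add: f_def A_def)
    hence "((\<lambda>a. f n a + g a + h a) has_sum G_upto n c z + q + w * X) (A (length c + 1))"
      by (intro has_sum_add g h)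
    also have "?this \<longleftrightarrow> (f (Suc n) has_sum G_upto n c z + q + w * X) (A (length c + 1))"
      by (intro has_sum_cong) (auto simp: Suc_eq g_def h_def A_def length_Suc_conv)
    finally have "X = G_upto n c z + q + w * X"
      using X has_sum_unique by blast
    hence "X * (1 - w) = G_upto n c z + q" by (simp add: algebra_simps)
    also have "\<dots> = G_upto (Suc n) c z * (1 - w)"
      using G_upto_Suc[OF hd, of n c] by (simp add: w_def q_def)
    finally have "X = G_upto (Suc n) c z"
      using one_minus_square_neq_0[OF hd, of n] by (simp add: w_def)
    thus ?case using X by (simp add: f_def A_def)
  qed
qed

lemma G_upto_of_real:
  "length z = length c + 1 \<Longrightarrow> G_upto n c (map of_real z) = (of_real (G_upto n c z) :: 'a::real_normed_field)"
proof (induction n c z rule: G_upto.induct)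
  case (2 n z)
  thus ?case by (cases z) auto
next
  case (3 n x c z)
  thus ?case by (cases z) auto
qed auto

text \<open>The complex sequence converges by \<open>G_upto_LIMSEQ\<close>, hence is bounded, and it
  agrees with the real one in norm.\<close>

lemma G_upto_bounded:
  fixes z :: "real list"
  assumes "length z = length c + 1" "\<forall>w\<in>set z. \<bar>w\<bar> < 1" "\<forall>x\<in>set c. 1 \<le> x \<and> x \<noteq> 2"
    and "c \<noteq> [] \<longrightarrow> 3 \<le> hd c"
  shows   "\<exists>C. \<forall>n. G_upto n c z \<le> C"
proof -
  obtain L where "(\<lambda>n. G_upto n c (map complex_of_real z)) \<longlonglongrightarrow> L"
    using G_upto_LIMSEQ[of "map complex_of_real z" c] assms by auto
  hence "Bseq (\<lambda>n. G_upto n c (map complex_of_real z))"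
    by (intro convergent_imp_Bseq convergentI)
  then obtain C where "\<And>n. norm (G_upto n c (map complex_of_real z)) \<le> C"
    by (auto simp: Bseq_def)
  hence "\<bar>G_upto n c z\<bar> \<le> C" for n
    using G_upto_of_real[OF assms(1), where ?'a = complex] by (metis norm_of_real)
  thus ?thesis by (meson abs_le_iff)
qed

text \<open>Dominated convergence over the exponents \<open>a\<close>. The majorant \<open>h\<close>
  has \<open>map norm z\<close> for \<open>z\<close> and the full \<open>tstar\<close>; it is
  summable because \<open>G_upto\<close> is bounded at \<open>map norm z\<close>.\<close>

lemma G_upto_tendsto_G:
  assumes "length z = length c + 1" "\<forall>w\<in>set z. norm w < 1" "\<forall>x\<in>set c. 1 \<le> x \<and> x \<noteq> 2"
    and "c \<noteq> [] \<longrightarrow> 3 \<le> hd c"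
  shows   "(\<lambda>n. G_upto n c z) \<longlonglongrightarrow> G c z"
proof -
  define A where "A = {a :: nat list. length a = length c + 1}"
  have bound: "\<exists>C. \<forall>n X. X \<subseteq> A \<longrightarrow> finite X \<longrightarrow> (\<Sum>a\<in>X. G_summand n c x a) \<le> C"
    if x: "length x = length c + 1" "\<forall>w\<in>set x. 0 \<le> w \<and> w < 1" for x :: "real list"
  proof -
    obtain C where C: "\<And>n. G_upto n c x \<le> C"
      using G_upto_bounded[OF x(1) _ assms(3,4)] x(2) by auto
    have "(\<Sum>a\<in>X. G_summand n c x a) \<le> C" if "X \<subseteq> A" "finite X" for n X
    proof -
      have "(\<Sum>a\<in>X. G_summand n c x a) \<le> G_upto n c x"
        using that x unfolding A_def
        by (intro finite_sum_le_has_sum[OF G_summand_has_sum] G_summand_nonneg) auto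
      also note C
      finally show ?thesis .
    qed
    thus ?thesis by blast
  qed
  have tstar: "(\<lambda>n. tstar_upto (G_index c a) n) \<longlonglongrightarrow> tstar (G_index c a)"
              "tstar_upto (G_index c a) n \<le> tstar (G_index c a)" if "a \<in> A" for a n
  proof -
    \<comment> \<open>Any point with coordinates strictly between 0 and 1 would do: a single term of
      the bounded series, with monomial \<open>P > 0\<close>, bounds its coefficient.\<close>
    define x :: "real list" where "x = replicate (length c + 1) (1/2)"
    define P where "P = (\<Prod>i\<le>length c. (x ! i) ^ (2 * (a ! i)))"
    have x: "length x = length c + 1" "\<forall>w\<in>set x. 0 \<le> w \<and> w < 1"
      by (simp_all add: x_def)
    have "0 < x ! i" if "i \<le> length c" for i
      unfolding x_def using that by (subst nth_replicate) auto
    hence P: "P > 0" unfolding P_def by (intro prod_pos) simp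
    obtain C where "\<And>n X. X \<subseteq> A \<Longrightarrow> finite X \<Longrightarrow> (\<Sum>a\<in>X. G_summand n c x a) \<le> C"
      using bound[OF x] by blast
    from this[of "{a}"] that have "tstar_upto (G_index c a) n * P \<le> C" for n
      by (simp add: G_summand_def P_def)
    hence "tstar_upto (G_index c a) n \<le> C / P" for n
      using P by (simp add: pos_le_divide_eq)
    from tstar_upto_LIMSEQ[OF this]
    show "(\<lambda>n. tstar_upto (G_index c a) n) \<longlonglongrightarrow> tstar (G_index c a)"
         "tstar_upto (G_index c a) n \<le> tstar (G_index c a)" by blast+
  qed
  define h where "h = (\<lambda>a. tstar (G_index c a) * (\<Prod>i\<le>length c. (map norm z ! i) ^ (2 * (a ! i))))"
  have P_nonneg: "0 \<le> (\<Prod>i\<le>length c. (map norm z ! i) ^ (2 * (a ! i)))" for a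
    using assms(1) by (intro prod_nonneg) auto
  have tstar_nonneg: "0 \<le> tstar (G_index c a)" if "a \<in> A" for a
    using tstar_upto_nonneg[of "G_index c a" 0] tstar(2)[OF that, of 0] by linarith
  have h: "h summable_on A"
  proof (rule nonneg_bdd_above_summable_on)
    show "0 \<le> h a" if "a \<in> A" for a
      unfolding h_def using that P_nonneg tstar_nonneg by auto
    obtain C where C: "\<And>n X. X \<subseteq> A \<Longrightarrow> finite X \<Longrightarrow> (\<Sum>a\<in>X. G_summand n c (map norm z) a) \<le> C"
      using bound[of "map norm z"] assms by auto
    show "bdd_above (sum h ` {X. X \<subseteq> A \<and> finite X})"
    proof (rule bdd_aboveI2)
      fix X assume X: "X \<in> {X. X \<subseteq> A \<and> finite X}"
      \<comment> \<open>Each finite sum of \<open>h\<close> is a limit of truncated sums, all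
        bounded by the same \<open>C\<close>.\<close>
      have "(\<lambda>n. \<Sum>a\<in>X. G_summand n c (map norm z) a) \<longlonglongrightarrow> sum h X"
        unfolding G_summand_def h_def of_real_eq_id id_apply using X
        by (intro tendsto_sum tendsto_mult tstar tendsto_const) auto
      thus "sum h X \<le> C"
        using C X by (intro LIMSEQ_le_const2) auto
    qed
  qed
  have bound_h: "norm (G_summand n c z a) \<le> h a" if "a \<in> A" for n a
    unfolding norm_G_summand[OF assms(1)] unfolding G_summand_def h_def of_real_eq_id id_apply
    using tstar(2)[OF that] P_nonneg by (intro mult_right_mono) auto
  have lim: "(\<lambda>n. G_summand n c z a) \<longlonglongrightarrow> of_real (tstar (G_index c a)) * (\<Prod>i\<le>length c. (z ! i) ^ (2 * (a ! i)))"
    if "a \<in> A" for a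
    unfolding G_summand_def by (intro tendsto_mult tendsto_of_real tstar that tendsto_const)
  have "(\<lambda>n. infsum (G_summand n c z) A) \<longlonglongrightarrow>
      infsum (\<lambda>a. of_real (tstar (G_index c a)) * (\<Prod>i\<le>length c. (z ! i) ^ (2 * (a ! i)))) A"
    using lim bound_h h by (rule infsum_dominated_convergence)
  moreover have "infsum (G_summand n c z) A = G_upto n c z" for n
    unfolding A_def by (intro infsumI G_summand_has_sum assms)
  ultimately show ?thesis by (simp add: G_def A_def)
qed

theorem theorem3p1:
  fixes d :: nat and c :: "nat list" and z :: "complex list"
  assumes "length c = d"
    and "\<forall>x\<in>set c. 1 \<le> x \<and> x \<noteq> 2"
    and "d \<ge> 1 \<longrightarrow> c ! 0 \<ge> 3"
    and "length z = d + 1"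
    and "\<forall>w\<in>set z. norm w < 1"
  shows "(\<lambda>N. complex_of_real (2 / pi) * (\<Sum>k\<in>rhs_idx d N. rhs_term c z k))
           \<longlonglongrightarrow> G c z"
proof -
  have z: "length z = length c + 1" using assms by simp
  have c: "c \<noteq> [] \<longrightarrow> 3 \<le> hd c" using assms by (cases c) auto
  obtain L where L: "(\<lambda>n. G_upto n c z) \<longlonglongrightarrow> L"
      "(\<lambda>n. \<Sum>k=1..n. of_real (- (4 / pi) * (-1) ^ k) * pf_term c z k) \<longlonglongrightarrow> L"
    using G_upto_LIMSEQ[OF z assms(5,2) c] by blast
  have "L = G c z"
    using L(1) G_upto_tendsto_G[OF z assms(5,2) c] by (rule LIMSEQ_unique)
  \<comment> \<open>The factor -2 from \<open>sum_rhs_term\<close> and \<open>2 / pi\<close> combine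
    to the limit \<open>- (4 / pi) * (-1)^k\<close> of \<open>kern\<close>.\<close>
  moreover have "complex_of_real (2 / pi) * (\<Sum>k\<in>rhs_idx d N. rhs_term c z k) =
      (\<Sum>k=1..N. of_real (- (4 / pi) * (-1) ^ k) * pf_term c z k)" for N
    unfolding assms(1) [symmetric] sum_rhs_term[OF z] sum_distrib_left
    by (intro sum.cong) simp_all
  ultimately show ?thesis using L(2) by simp
qed

end
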